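(* Let $1 < p \leq q < \infty$, let $p' := p/(p-1)$ and $q' := q/(q-1)$, let $0 \leq m \leq \infty$, let $\tilde\nu_n$ ($0\le n\le m$, $n$ an integer) be positive regular Borel measures on $[0,\infty)$, each satisfying the $\Delta_2$-condition, let $\nu_n := \tilde\nu_n\otimes\lambda$, and let $\mu$ be a positive Borel measure on $\mathbb{C}_+$. If $\rho$ is a regular weight on $\mathbb{C}_+$ such that $$\int_{\mathbb{C}_+} |F'(z)|^p (\operatorname{Re}(z))^{p-2} \rho(z)\,dz \leq \|F\|^p_{A^p(\mathbb{C}_+,(\nu_n)_{n=0}^m)}$$ for all $F \in A^p(\mathbb{C}_+,(\nu_n)_{n=0}^m)$, and there exists a constant $C(\mu,\rho) > 0$ such that $$\left(\int_{Q(a)} \frac{\left(\mu(Q(a)\cap Q(z))\right)^{p'}}{(\operatorname{Re}(z))^2} \rho(z)^{1-p'}\,dz\right)^{q'/p'} \leq C(\mu,\rho)\, \mu(Q(a)) \qquad (\forall a \in \mathbb{C}_+),$$ then the embedding $$A^p(\mathbb{C}_+,(\nu_n)_{n=0}^m) \hookrightarrow L^q(\mathbb{C}_+,\mu)$$ is bounded.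
   Context: $\mathbb{C}_+ := \{z : \operatorname{Re}(z) > 0\}$, $\overline{\mathbb{C}_+} = [0,\infty)\times i\mathbb{R}$, and $dz$ in the integrals denotes area (planar Lebesgue) measure. A positive regular Borel measure $\tilde\nu$ on $[0,\infty)$ satisfies the $\Delta_2$-condition if $\sup_{r>0} \tilde\nu[0,2r)/\tilde\nu[0,r) < \infty$. $\lambda$ is Lebesgue measure on $i\mathbb{R}$. For an analytic function $F$ on $\mathbb{C}_+$ and $\nu=\tilde\nu\otimes\lambda$ (a measure on $\overline{\mathbb{C}_+}$), $$\|F\|^p_{A^p_\nu} := \sup_{\varepsilon > 0} \int_{\overline{\mathbb{C}_+}} |F(z+\varepsilon)|^p\,d\nu(z),$$ and $A^p(\mathbb{C}_+, (\nu_n)_{n=0}^m)$ is the space of analytic $F : \mathbb{C}_+\to\mathbb{C}$ with $\|F\|^p_{A^p(\mathbb{C}_+,(\nu_n)_{n=0}^m)} := \sum_{n=0}^m \|F^{(n)}\|^p_{A^p_{\nu_n}} < \infty$. The embedding into $L^q(\mathbb{C}_+,\mu)$ is bounded if there is $C>0$ with $\left(\int_{\mathbb{C}_+}|F|^q\,d\mu\right)^{1/q} \leq C\|F\|_{A^p(\mathbb{C}_+,(\nu_n)_{n=0}^m)}$ for all $F$ in the space. For $a \in \mathbb{C}_+$ the Carleson square centred at $a$ is $Q(a) := \{z = x+iy : 0 \leq x < 2\operatorname{Re}(a),\ |y - \operatorname{Im}(a)| \leq \operatorname{Re}(a)\}$ (intersected with $\mathbb{C}_+$ when measured by $\mu$).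 A measurable function $\rho : \mathbb{C}_+ \to (0,\infty)$ is a regular weight if for every $\varepsilon > 0$ there is $\delta > 0$ such that $\rho(z_1) \leq \delta\rho(z_2)$ whenever the hyperbolic (Poincaré) distance in $\mathbb{C}_+$ between $z_1$ and $z_2$, namely $\cosh^{-1}\left(1 + \frac{|z_1-z_2|^2}{2\operatorname{Re}(z_1)\operatorname{Re}(z_2)}\right)$, is at most $\varepsilon$.
   Formalization: The testing condition also requires μ(Q(a)) < ∞ for all a (else it is trivially true for μ = dz/Re(z)^10, p = q = 2, where the Bergman space does not embed); the Δ₂-condition includes 0 < ν̃_n[0,r) < ∞, which excludes only the zero measure. *)

theory Defs
  imports "HOL-Analysis.Analysis" "HOL-Library.Extended_Nat"
begin

definition right_half_plane :: "complex set" where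
  "right_half_plane = {z. 0 < Re z}"

definition closed_right_half_plane :: "complex set" where
  "closed_right_half_plane = {z. 0 \<le> Re z}"

(* Real powers of extended nonnegative reals; used only with exponents a > 0, hence \<infinity>^a = \<infinity>. *)
definition ennpowr :: "ennreal \<Rightarrow> real \<Rightarrow> ennreal" where
  "ennpowr x a = (if x = \<infinity> then \<infinity> else ennreal (enn2real x powr a))"

definition borel_measure_on :: "'a::topological_space set \<Rightarrow> 'a measure \<Rightarrow> bool" where
  "borel_measure_on S M \<longleftrightarrow> sets M = sets (restrict_space borel S)"

definition regular_borel_measure_on :: "'a::topological_space set \<Rightarrow> 'a measure \<Rightarrow> bool" where
  "regular_borel_measure_on S M \<longleftrightarrow> borel_measure_on S M \<and>
     (\<forall>K. compact K \<and> K \<subseteq> S \<longrightarrow> emeasure M K < \<infinity>) \<and>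
     (\<forall>A\<in>sets M. emeasure M A = (INF U\<in>{U. openin (top_of_set S) U \<and> A \<subseteq> U}. emeasure M U)) \<and>
     (\<forall>A\<in>sets M. emeasure M A = (SUP K\<in>{K. compact K \<and> K \<subseteq> A}. emeasure M K))"

(* The first conjunct says that the quotients are meaningful. It has to be stated, since in ennreal
   0 / 0 = 0 and \<infinity> / \<infinity> = 0; given local finiteness, it excludes only the zero measure. *)
definition Delta2 :: "real measure \<Rightarrow> bool" where
  "Delta2 M \<longleftrightarrow> (\<forall>r>0. 0 < emeasure M {0..<r} \<and> emeasure M {0..<r} < \<infinity>) \<and>
     (SUP r\<in>{0<..}. emeasure M {0..<2 * r} / emeasure M {0..<r}) < \<infinity>"

(* The measure M \<otimes> \<lambda> on [0,\<infinity>) \<times> i\<real>, transported to the closed half-plane. *)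
definition half_plane_measure :: "real measure \<Rightarrow> complex measure" where
  "half_plane_measure M =
     distr (M \<Otimes>\<^sub>M lborel) (restrict_space borel closed_right_half_plane) (\<lambda>(x, y). Complex x y)"

(* The p-th power of the A^p_\<nu> norm. *)
definition zen_norm_pow :: "real \<Rightarrow> complex measure \<Rightarrow> (complex \<Rightarrow> complex) \<Rightarrow> ennreal" where
  "zen_norm_pow p \<nu> F =
     (SUP \<epsilon>\<in>{0<..}. \<integral>\<^sup>+z. ennreal (cmod (F (z + complex_of_real \<epsilon>)) powr p) \<partial>\<nu>)"

(* The p-th power of the A^p(C_+, (\<nu>_n)_{n=0}^m) norm, where \<nu>_n is the product of N n with \<lambda>. *)
definition Ap_norm_pow ::
    "real \<Rightarrow> enat \<Rightarrow> (nat \<Rightarrow> real measure) \<Rightarrow> (complex \<Rightarrow> complex) \<Rightarrow> ennreal" where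
  "Ap_norm_pow p m N F =
     (\<Sum>n. if enat n \<le> m then zen_norm_pow p (half_plane_measure (N n)) ((deriv ^^ n) F) else 0)"

definition Ap_norm ::
    "real \<Rightarrow> enat \<Rightarrow> (nat \<Rightarrow> real measure) \<Rightarrow> (complex \<Rightarrow> complex) \<Rightarrow> ennreal" where
  "Ap_norm p m N F = ennpowr (Ap_norm_pow p m N F) (1 / p)"

definition Ap_space ::
    "real \<Rightarrow> enat \<Rightarrow> (nat \<Rightarrow> real measure) \<Rightarrow> (complex \<Rightarrow> complex) set" where
  "Ap_space p m N = {F. F holomorphic_on right_half_plane \<and> Ap_norm_pow p m N F < \<infinity>}"

definition bounded_embedding ::
    "real \<Rightarrow> enat \<Rightarrow> (nat \<Rightarrow> real measure) \<Rightarrow> real \<Rightarrow> complex measure \<Rightarrow> bool" where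
  "bounded_embedding p m N q \<mu> \<longleftrightarrow>
     (\<exists>C::real. C > 0 \<and> (\<forall>F\<in>Ap_space p m N.
        ennpowr (\<integral>\<^sup>+z. ennreal (cmod (F z) powr q) \<partial>\<mu>) (1 / q) \<le> ennreal C * Ap_norm p m N F))"

definition carleson_square :: "complex \<Rightarrow> complex set" where
  "carleson_square a = {z. 0 \<le> Re z \<and> Re z < 2 * Re a \<and> \<bar>Im z - Im a\<bar> \<le> Re a}"

definition hyperbolic_dist :: "complex \<Rightarrow> complex \<Rightarrow> real" where
  "hyperbolic_dist z w = arcosh (1 + (cmod (z - w))\<^sup>2 / (2 * Re z * Re w))"

definition regular_weight :: "(complex \<Rightarrow> real) \<Rightarrow> bool" where
  "regular_weight \<rho> \<longleftrightarrow>
     \<rho> \<in> borel_measurable (lebesgue_on right_half_plane) \<and>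
     (\<forall>z\<in>right_half_plane. 0 < \<rho> z) \<and>
     (\<forall>\<epsilon>>0. \<exists>\<delta>>0. \<forall>z\<in>right_half_plane. \<forall>w\<in>right_half_plane.
        hyperbolic_dist z w \<le> \<epsilon> \<longrightarrow> \<rho> z \<le> \<delta> * \<rho> w)"

(* The testing inequality is one between finite numbers. Reading \<infinity> \<le> \<infinity> as true would be vacuous
   for measures with mu(Q(a)) = \<infinity>. Finiteness of all right-hand sides is equivalent to
   finiteness of all left-hand sides: if mu(Q(b)) = \<infinity>, then Q(b) is contained in Q(z) for a
   set of z of positive area in a larger Q(a). *)
definition testing_condition :: "real \<Rightarrow> real \<Rightarrow> complex measure \<Rightarrow> (complex \<Rightarrow> real) \<Rightarrow> bool" where
  "testing_condition p' q' \<mu> \<rho> \<longleftrightarrow> (\<exists>C::real. C > 0 \<and> (\<forall>a\<in>right_half_plane.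
     emeasure \<mu> (carleson_square a \<inter> right_half_plane) < \<infinity> \<and>
     ennpowr
       (\<integral>\<^sup>+z\<in>carleson_square a \<inter> right_half_plane.
         ennpowr (emeasure \<mu> (carleson_square a \<inter> carleson_square z \<inter> right_half_plane)) p'
           / ennreal ((Re z)\<^sup>2) * ennreal (\<rho> z powr (1 - p')) \<partial>lebesgue)
       (q' / p')
     \<le> ennreal C * emeasure \<mu> (carleson_square a \<inter> right_half_plane)))"

end

theory Submission
  imports Defs "HOL-Complex_Analysis.Complex_Analysis" "HOL-Real_Asymp.Real_Asymp"
begin

text \<open>
  Membership in \<open>A\<^sup>p\<close> with \<open>\<nu>\<^sub>0\<close> charging neighbourhoods of \<open>0\<close> forces \<open>F\<close> to vanish at infinity along horizontal
  rays, so \<open>F w\<close> is the integral of \<open>F'\<close> over the ray to the right of \<open>w\<close>. Cutting the ray into dyadic pieces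
  bounds \<open>|F w|\<close> by the sum, over the dyadic Carleson squares containing \<open>w\<close>, of side length times the maximum
  of \<open>|F'|\<close> on the top half of the square. By the mean value property, and since a regular weight is essentially
  constant on top halves, the weighted \<open>p\<close>-th powers of these numbers sum to at most a constant times
  \<open>\<integral>|F'|\<^sup>p (Re z)\<^sup>p\<^sup>-\<^sup>2 \<rho>\<close>. What remains is a two-weight Hardy inequality on the dyadic tree. There, telescoping \<open>q\<close>-th
  powers along branches writes the left-hand side as a sum over the tree; after Young's inequality the dual
  sum is telescoped once more and summed by the testing condition, which returns a power of the left-hand side.
\<close>

text \<open>The q-th power of a branch sum is not linear in its terms. Written as the sum of its
  increments along the branch, it integrates to a combination of the masses of single cells, and
  such masses are all that a testing condition sees. The assumption p \<le> q enters through the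
  exponent p'/q' \<ge> 1: by convexity, powers with this exponent can be differenced a second time.
  The left-hand side X of the Hardy inequality then reappears on the right and has to be absorbed,
  which requires it to be finite. Therefore the inequality is proved for finite sets of cells with
  constants independent of the set, and monotone convergence comes last. Two kinds of squares are in
  play: half-open cells, which form a tree, and the Carleson squares of the testing condition, which
  contain both horizontal edges. The masses of the latter serve as weights in the tree inequality;
  it suffices that they are monotone and dominate the masses of the cells.\<close>

section \<open>Elementary inequalities for real powers\<close>

text \<open>This is convexity: the graph of x^s lies above its tangent at u. Young's inequality for
  the product of \<open>v\<close> and \<open>u powr (s - 1)\<close> gives it without
  derivatives.\<close>

lemma powr_diff_le:
  fixes u v s :: real
  assumes "1 \<le> s" "0 \<le> v" "v \<le> u"
  shows "u powr s - v powr s \<le> s * (u - v) * u powr (s - 1)"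
proof (cases "s = 1 \<or> u = 0")
  case True
  then show ?thesis using assms by (cases "u = 0") auto
next
  case False
  then have s: "1 < s" and u: "0 < u" using assms by auto
  have "v * u powr (s - 1) \<le> v powr s / s + (u powr (s - 1)) powr (s / (s - 1)) / (s / (s - 1))"
    using s assms by (intro Youngs_inequality) (auto simp: field_simps)
  also have "(u powr (s - 1)) powr (s / (s - 1)) = u powr s"
    using s by (simp add: powr_powr)
  finally have "s * (v * u powr (s - 1)) \<le> v powr s + u powr s * (s - 1)"
    using s by (simp add: field_simps)
  moreover have "u * u powr (s - 1) = u powr s"
    using u by (simp add: powr_diff)
  ultimately show ?thesis by (simp add: algebra_simps)
qed

text \<open>The weight \<open>w\<close> produces the two dual weights \<open>w\<close> and
  \<open>w powr (1 - p')\<close>; the free parameter \<open>t\<close> later allows the second term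
  to be absorbed.\<close>

lemma young_weighted:
  fixes g v w t p p' :: real
  assumes p: "1 < p" "p' = p / (p - 1)" and "0 \<le> g" "0 \<le> v" "0 < w" "0 < t"
  shows "g * v \<le> t * (g powr p * w) + t powr (1 - p') * (v powr p' * w powr (1 - p'))"
proof -
  have p': "1 < p'" "1 / p + 1 / p' = 1" using p(1) unfolding p(2) by (simp_all add: field_simps)
  have e: "- (p' / p) = 1 - p'" using p(1) unfolding p(2) by (simp add: field_simps)
  have divide_le_self: "x / s \<le> x" if "1 < s" "0 \<le> x" for x s :: real
    using that by (simp add: divide_le_eq mult_le_cancel_left1)
  \<comment> \<open>Shifting \<open>h\<close> from one factor to the other makes the first power
    equal to \<open>t * (g powr p * w)\<close>. The second then carries the power - p' of
    \<open>h\<close>, and - p'/p = 1 - p'.\<close>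
  define h where "h = (t * w) powr (1 / p)"
  have h: "0 < h" using assms by (simp add: h_def)
  have "g * v = (g * h) * (v * (1 / h))" using h by simp
  also have "\<dots> \<le> (g * h) powr p / p + (v * (1 / h)) powr p' / p'"
    using assms p' h by (intro Youngs_inequality) auto
  also have "\<dots> \<le> (g * h) powr p + (v * (1 / h)) powr p'"
    using p(1) p' by (intro add_mono divide_le_self) auto
  also have "(g * h) powr p = t * (g powr p * w)"
    using assms h by (simp add: powr_mult h_def powr_powr)
  also have "(1 / h) powr p' = (t * w) powr (1 - p')"
    using assms h e by (simp add: powr_divide h_def powr_powr powr_minus_divide[symmetric])
  then have "(v * (1 / h)) powr p' = t powr (1 - p') * (v powr p' * w powr (1 - p'))"
    using assms h by (subst powr_mult) (auto simp: powr_mult)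
  finally show ?thesis .
qed

section \<open>Branches and the Hardy inequality in a laminar family\<close>

text \<open>Inserting the elements by decreasing level leaves the tail sums of those already present
  unchanged; the new element contributes the step from the old total to the new one.\<close>

lemma chain_telescope:
  fixes lv :: "'a \<Rightarrow> int" and g :: "'a \<Rightarrow> real" and \<phi> :: "real \<Rightarrow> real"
  assumes "finite A" "inj_on lv A"
  shows "(\<Sum>a\<in>A. \<phi> (\<Sum>b | b \<in> A \<and> lv a \<le> lv b. g b) - \<phi> (\<Sum>b | b \<in> A \<and> lv a < lv b. g b))
       = \<phi> (sum g A) - \<phi> 0"
  using assms
proof (induction rule: finite_ranking_induct[where f = "\<lambda>x. - lv x"])
  case empty
  then show ?case by simp
next
  case (insert x S)
  show ?case
  proof (cases "x \<in> S")
    case True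
    then show ?thesis using insert by (simp add: insert_absorb)
  next
    case False
    have less: "lv x < lv y" if "y \<in> S" for y
    proof -
      have "lv x \<noteq> lv y" using insert.prems False that by (auto simp: inj_on_def)
      with insert.hyps(2)[OF that] show ?thesis by simp
    qed
    have eq1: "{b. b \<in> insert x S \<and> lv a \<le> lv b} = {b. b \<in> S \<and> lv a \<le> lv b}"
      "{b. b \<in> insert x S \<and> lv a < lv b} = {b. b \<in> S \<and> lv a < lv b}" if "a \<in> S" for a
      using less[OF that] by auto
    have eq2: "{b. b \<in> insert x S \<and> lv x \<le> lv b} = insert x S"
      "{b. b \<in> insert x S \<and> lv x < lv b} = S"
      using less by (auto intro: less_imp_le)
    have "inj_on lv S" using insert.prems by (auto simp: inj_on_def)
    from insert.IH[OF this]
    have "(\<Sum>a\<in>S. \<phi> (\<Sum>b | b \<in> insert x S \<and> lv a \<le> lv b. g b)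
             - \<phi> (\<Sum>b | b \<in> insert x S \<and> lv a < lv b. g b)) = \<phi> (sum g S) - \<phi> 0"
      using eq1 by (simp cong: sum.cong)
    then show ?thesis
      using False insert.hyps(1) unfolding sum.insert[OF insert.hyps(1) False] eq2 by simp
  qed
qed

text \<open>A finite piece of a forest ordered by inclusion. Levels turn inclusion of sets that meet
  into an order of integers, so that branches are chains; nonemptiness ensures that all sets above a
  given one meet each other.\<close>

locale laminar_family =
  fixes S :: "'a set" and P :: "'a \<Rightarrow> 'b set" and lv :: "'a \<Rightarrow> int"
  assumes finite_S: "finite S"
    and nonempty: "a \<in> S \<Longrightarrow> P a \<noteq> {}"
    and nested: "a \<in> S \<Longrightarrow> b \<in> S \<Longrightarrow> P a \<inter> P b \<noteq> {} \<Longrightarrow> P a \<subseteq> P b \<longleftrightarrow> lv a \<le> lv b"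
    and same_level: "a \<in> S \<Longrightarrow> b \<in> S \<Longrightarrow> P a \<inter> P b \<noteq> {} \<Longrightarrow> lv a = lv b \<Longrightarrow> a = b"
begin

text \<open>The discrete Hardy operator on the tree. Since \<open>a\<close> itself is counted,
  \<open>up_sum g a - g a\<close> is the value at the parent of \<open>a\<close>, or 0 at a
  root.\<close>

definition up_sum :: "('a \<Rightarrow> real) \<Rightarrow> 'a \<Rightarrow> real" where
  "up_sum g a = (\<Sum>b | b \<in> S \<and> P a \<subseteq> P b. g b)"

text \<open>A pairwise meeting, upward closed set is one branch, and upward closure keeps the sums
  defining \<open>up_sum\<close> inside it. The two instances below are the sets through a point and
  the sets above a given member.\<close>

lemma up_set_telescope:
  assumes A: "A \<subseteq> S" and inter: "\<And>a b. a \<in> A \<Longrightarrow> b \<in> A \<Longrightarrow> P a \<inter> P b \<noteq> {}"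
    and up: "\<And>a b. a \<in> A \<Longrightarrow> b \<in> S \<Longrightarrow> P a \<subseteq> P b \<Longrightarrow> b \<in> A"
  shows "(\<Sum>a\<in>A. \<phi> (up_sum g a) - \<phi> (up_sum g a - g a)) = \<phi> (sum g A) - (\<phi> 0 :: real)"
proof -
  have fin: "finite A" using A finite_S by (rule finite_subset)
  have inj: "inj_on lv A"
  proof (rule inj_onI)
    fix a b assume "a \<in> A" "b \<in> A" "lv a = lv b"
    then show "a = b" using same_level[of a b] inter[of a b] A by blast
  qed
  have 1: "up_sum g a = (\<Sum>b | b \<in> A \<and> lv a \<le> lv b. g b)" if "a \<in> A" for a
  proof -
    have "{b. b \<in> S \<and> P a \<subseteq> P b} = {b. b \<in> A \<and> lv a \<le> lv b}"
    proof (intro equalityI subsetI; clarify)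
      fix b assume "b \<in> S" "P a \<subseteq> P b"
      then have "b \<in> A" using up that by blast
      then show "b \<in> A \<and> lv a \<le> lv b"
        using nested[of a b] inter[of a b] A that \<open>P a \<subseteq> P b\<close> by blast
    next
      fix b assume "b \<in> A" "lv a \<le> lv b"
      then show "b \<in> S \<and> P a \<subseteq> P b"
        using nested[of a b] inter[of a b] A that by blast
    qed
    then show ?thesis by (simp add: up_sum_def)
  qed
  have 2: "up_sum g a - g a = (\<Sum>b | b \<in> A \<and> lv a < lv b. g b)" if a: "a \<in> A" for a
  proof -
    have "{b. b \<in> A \<and> lv a \<le> lv b} = insert a {b. b \<in> A \<and> lv a < lv b}"
      using inj a by (auto simp: inj_on_def less_le)
    then show ?thesis using fin 1[OF a] by simp
  qed
  show ?thesis
    unfolding chain_telescope[OF fin inj, of \<phi> g, symmetric]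
  proof (intro sum.cong refl)
    fix a assume a: "a \<in> A"
    show "\<phi> (up_sum g a) - \<phi> (up_sum g a - g a) = \<phi> (\<Sum>b | b \<in> A \<and> lv a \<le> lv b. g b)
        - \<phi> (\<Sum>b | b \<in> A \<and> lv a < lv b. g b)"
      unfolding 2[OF a] unfolding 1[OF a] ..
  qed
qed

lemma up_set_of_point:
  "(\<Sum>a | a \<in> S \<and> x \<in> P a. \<phi> (up_sum g a) - \<phi> (up_sum g a - g a))
     = \<phi> (\<Sum>a | a \<in> S \<and> x \<in> P a. g a) - (\<phi> 0 :: real)"
  by (rule up_set_telescope) auto

lemma up_set_of_member:
  "a \<in> S \<Longrightarrow> (\<Sum>b | b \<in> S \<and> P a \<subseteq> P b. \<phi> (up_sum g b) - \<phi> (up_sum g b - g b))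
     = \<phi> (up_sum g a) - (\<phi> 0 :: real)"
  unfolding up_sum_def[of g a] by (rule up_set_telescope) (use nonempty[of a] in auto)

lemma up_sum_ge:
  assumes "a \<in> S" "\<And>b. b \<in> S \<Longrightarrow> 0 \<le> g b"
  shows "0 \<le> g a" "0 \<le> up_sum g a - g a"
proof -
  have "up_sum g a = g a + sum g ({b. b \<in> S \<and> P a \<subseteq> P b} - {a})"
    unfolding up_sum_def using assms finite_S by (intro sum.remove) auto
  moreover have "0 \<le> sum g ({b. b \<in> S \<and> P a \<subseteq> P b} - {a})"
    using assms by (intro sum_nonneg) auto
  ultimately show "0 \<le> up_sum g a - g a" by simp
qed (use assms in auto)

text \<open>The exponent \<open>p' * (q - 1) / q\<close> is \<open>p' / q'\<close>.\<close>

lemma testing_imp_hardy: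
  fixes g m w :: "'a \<Rightarrow> real" and p q p' C :: real
  defines "r \<equiv> p' * (q - 1) / q"
  defines "X \<equiv> \<Sum>a\<in>S. (up_sum g a powr q - (up_sum g a - g a) powr q) * m a"
  assumes p: "1 < p" "p \<le> q" "p' = p / (p - 1)" and C: "0 < C"
    and g: "\<And>a. a \<in> S \<Longrightarrow> 0 \<le> g a" and m: "\<And>a. a \<in> S \<Longrightarrow> 0 \<le> m a"
    and w: "\<And>a. a \<in> S \<Longrightarrow> 0 < w a"
    and mono: "\<And>a b. a \<in> S \<Longrightarrow> b \<in> S \<Longrightarrow> P b \<subseteq> P a \<Longrightarrow> m b \<le> m a"
    and test: "\<And>a. a \<in> S \<Longrightarrow>
      (\<Sum>b | b \<in> S \<and> P b \<subseteq> P a. m b powr p' * w b powr (1 - p')) \<le> C * m a powr r"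
  shows "X powr (p / q) \<le> 2 * q * (2 * q * (C * r)) powr (p - 1) * (\<Sum>a\<in>S. g a powr p * w a)"
proof -
  have q: "1 < q" using p by simp
  have p': "1 < p'" using p(1) unfolding p(3) by (simp add: field_simps)
  have r: "1 \<le> r" using p(1,2) unfolding r_def p(3) by (simp add: field_simps)
  have qr: "q * r = (q - 1) * p'" using q by (simp add: r_def)
  define u where "u = up_sum g"
  define b where "b a = m a powr p' * w a powr (1 - p')" for a
  define D where "D a = u a powr q - (u a - g a) powr q" for a
  have ug: "0 \<le> g a" "0 \<le> u a - g a" "0 \<le> u a" if "a \<in> S" for a
    using up_sum_ge[of a g, OF that g] by (simp_all add: u_def)
  have D0: "0 \<le> D a" if "a \<in> S" for a
    unfolding D_def using ug[OF that] q by (simp add: powr_mono2)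
  have X: "X = (\<Sum>a\<in>S. D a * m a)" by (simp add: X_def D_def u_def)
  have X0: "0 \<le> X" unfolding X using D0 m by (intro sum_nonneg) auto
  \<comment> \<open>The power u^q telescopes over the ancestors of \<open>a\<close>, and
    \<open>m\<close> grows towards them, so replacing \<open>m a\<close> by the masses of the
    ancestors yields a part of the sum \<open>X\<close>.\<close>
  have um: "u a powr q * m a \<le> X" if a: "a \<in> S" for a
  proof -
    have "u a powr q * m a = (\<Sum>c | c \<in> S \<and> P a \<subseteq> P c. D c) * m a"
      using up_set_of_member[OF a, of "\<lambda>x. x powr q" g] by (simp add: D_def u_def)
    also have "\<dots> = (\<Sum>c | c \<in> S \<and> P a \<subseteq> P c. D c * m a)" by (simp add: sum_distrib_right)
    also have "\<dots> \<le> (\<Sum>c | c \<in> S \<and> P a \<subseteq> P c. D c * m c)"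
      using D0 mono a by (intro sum_mono mult_left_mono) auto
    also have "\<dots> \<le> X" unfolding X using D0 m finite_S by (intro sum_mono2) auto
    finally show ?thesis .
  qed
  \<comment> \<open>Convexity is applied to the q-th powers with exponent \<open>r\<close>, not to
    \<open>u\<close> with exponent q r: the bound then contains \<open>D a\<close>, from which
    \<open>X\<close> can be rebuilt.\<close>
  have Dr: "u a powr (q * r) - (u a - g a) powr (q * r) \<le> r * D a * u a powr (q * (r - 1))"
    if a: "a \<in> S" for a
    using powr_diff_le[OF r, of "(u a - g a) powr q" "u a powr q"] ug[OF a] q
    by (simp add: powr_powr D_def powr_mono2)
  \<comment> \<open>The dual sum. Once the power is telescoped over ancestors and the sums are
    exchanged, the inner sum runs over the descendants of \<open>c\<close> and is the one that the
    testing hypothesis bounds.\<close>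
  have "(\<Sum>a\<in>S. u a powr (q * r) * b a)
      = (\<Sum>a\<in>S. \<Sum>c | c \<in> S \<and> P a \<subseteq> P c. (u c powr (q * r) - (u c - g c) powr (q * r)) * b a)"
    using up_set_of_member[of _ "\<lambda>x. x powr (q * r)" g]
    by (intro sum.cong refl) (simp add: sum_distrib_right[symmetric] u_def)
  also have "\<dots> = (\<Sum>c\<in>S. \<Sum>a | a \<in> S \<and> P a \<subseteq> P c. (u c powr (q * r) - (u c - g c) powr (q * r)) * b a)"
    using finite_S by (rule sum.swap_restrict) (rule finite_S)
  also have "\<dots> = (\<Sum>c\<in>S. (u c powr (q * r) - (u c - g c) powr (q * r)) * (\<Sum>a | a \<in> S \<and> P a \<subseteq> P c. b a))"
    by (simp add: sum_distrib_left)
  also have "\<dots> \<le> (\<Sum>c\<in>S. C * r * X powr (r - 1) * (D c * m c))"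
  proof (rule sum_mono)
    fix c assume c: "c \<in> S"
    have "(u c powr (q * r) - (u c - g c) powr (q * r)) * (\<Sum>a | a \<in> S \<and> P a \<subseteq> P c. b a)
        \<le> (r * D c * u c powr (q * (r - 1))) * (C * m c powr r)"
      using Dr[OF c] test[OF c] r D0[OF c] by (intro mult_mono) (auto simp: b_def intro!: sum_nonneg)
    \<comment> \<open>One factor \<open>m c\<close> is kept for the summand \<open>D c * m c\<close>
      of \<open>X\<close>; the others combine with \<open>u c\<close> to a power of
      \<open>u c powr q * m c\<close>, which \<open>um\<close> bounds by \<open>X\<close>.\<close>
    also have "m c powr r = m c powr (r - 1) * m c"
      using m[OF c] by (cases "m c = 0") (auto simp: powr_diff)
    also have "(r * D c * u c powr (q * (r - 1))) * (C * (m c powr (r - 1) * m c))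
       = C * r * (u c powr q * m c) powr (r - 1) * (D c * m c)"
      using m[OF c] by (simp add: powr_mult powr_powr)
    also have "\<dots> \<le> C * r * X powr (r - 1) * (D c * m c)"
      using C r um[OF c] m[OF c] D0[OF c] by (intro mult_right_mono mult_left_mono powr_mono2) auto
    finally show "(u c powr (q * r) - (u c - g c) powr (q * r)) * (\<Sum>a | a \<in> S \<and> P a \<subseteq> P c. b a)
        \<le> C * r * X powr (r - 1) * (D c * m c)" .
  qed
  also have "\<dots> = C * r * X powr (r - 1) * X" by (simp add: X sum_distrib_left)
  finally have dual: "(\<Sum>a\<in>S. u a powr (q * r) * b a) \<le> C * r * X powr (r - 1) * X" .
  define A where "A = (\<Sum>a\<in>S. g a powr p * w a)"
  show ?thesis
  proof (cases "X = 0")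
    case True
    have "0 \<le> A" using w by (auto simp: A_def intro!: sum_nonneg mult_nonneg_nonneg less_imp_le[of 0 "w _"])
    then show ?thesis using True q by (simp add: A_def)
  next
    case False
    with X0 have Xp: "0 < X" by simp
    \<comment> \<open>This \<open>t\<close> solves q t^(1-p') C r X^r = X/2, because (p - 1)(1 - p')
      = -1; the dual term becomes half of the left-hand side.\<close>
    define t where "t = (2 * q * (C * r) * X powr (r - 1)) powr (p - 1)"
    have base: "0 < 2 * q * (C * r) * X powr (r - 1)" using q C r Xp by simp
    then have t: "0 < t" unfolding t_def powr_gt_zero by (metis less_irrefl)
    have "(p - 1) * (1 - p') = - 1" using p(1) unfolding p(3) by (simp add: field_simps)
    then have t': "t powr (1 - p') = 1 / (2 * q * (C * r) * X powr (r - 1))"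
      using base q C r Xp by (simp add: t_def powr_powr powr_minus_divide)
    have "X \<le> (\<Sum>a\<in>S. q * (g a * (u a powr (q - 1) * m a)))"
      unfolding X
    proof (rule sum_mono)
      fix a assume a: "a \<in> S"
      have "D a \<le> q * g a * u a powr (q - 1)"
        using powr_diff_le[of q "u a - g a" "u a"] q ug[OF a] by (simp add: D_def)
      from mult_right_mono[OF this m[OF a]]
      show "D a * m a \<le> q * (g a * (u a powr (q - 1) * m a))" by (simp only: mult.assoc)
    qed
    also have "\<dots> \<le> (\<Sum>a\<in>S. q * (t * (g a powr p * w a) + t powr (1 - p') * (u a powr (q * r) * b a)))"
    proof (intro sum_mono mult_left_mono)
      fix a assume a: "a \<in> S"
      have "(u a powr (q - 1) * m a) powr p' * w a powr (1 - p') = u a powr (q * r) * b a"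
        using m[OF a] by (simp add: powr_mult powr_powr b_def qr)
      then show "g a * (u a powr (q - 1) * m a)
          \<le> t * (g a powr p * w a) + t powr (1 - p') * (u a powr (q * r) * b a)"
        using young_weighted[OF p(1,3) ug(1)[OF a], of "u a powr (q - 1) * m a" "w a" t] m[OF a] w[OF a] t
        by simp
    qed (use q in auto)
    also have "\<dots> = q * (t * A + t powr (1 - p') * (\<Sum>a\<in>S. u a powr (q * r) * b a))"
      by (simp add: A_def sum_distrib_left sum.distrib algebra_simps)
    also have "\<dots> \<le> q * (t * A + t powr (1 - p') * (C * r * X powr (r - 1) * X))"
      using q dual by (intro mult_left_mono add_left_mono) auto
    also have "\<dots> = q * t * A + X / 2"
      using q C r Xp by (simp add: t' field_simps)
    finally have XA: "X \<le> 2 * q * t * A" by simp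
    \<comment> \<open>Hence \<open>t\<close> contributes the factor X^(1-p/q), whose cancellation
      leaves the power p/q of X.\<close>
    have "(r - 1) * (p - 1) = 1 - p / q" using p(1) q unfolding r_def p(3) by (simp add: field_simps)
    then have t2: "t = (2 * q * (C * r)) powr (p - 1) * X powr (1 - p / q)"
      using q C r Xp by (simp add: t_def powr_mult powr_powr)
    have "X powr (p / q) * X powr (1 - p / q) = X" using Xp by (simp flip: powr_add)
    also have "\<dots> \<le> (2 * q * (2 * q * (C * r)) powr (p - 1) * A) * X powr (1 - p / q)"
      using XA by (simp add: t2 mult_ac)
    finally show ?thesis
      using Xp by (simp add: A_def)
  qed
qed

end

section \<open>Area measure of the plane as a product measure\<close>

lemma lborel_complex_eq:
  "(lborel :: complex measure) = distr (lborel \<Otimes>\<^sub>M lborel) borel (\<lambda>(x, y). Complex x y)"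
proof (rule lborel_eqI)
  have [measurable]: "(\<lambda>(x, y). Complex x y) \<in> borel_measurable (lborel \<Otimes>\<^sub>M lborel)"
    by (simp add: Complex_eq[abs_def] split_beta')
  fix l u :: complex
  assume le: "\<And>b. b \<in> Basis \<Longrightarrow> l \<bullet> b \<le> u \<bullet> b"
  have le': "Re l \<le> Re u" "Im l \<le> Im u" using le[of 1] le[of \<i>] by (auto simp: Basis_complex_def)
  have "(\<lambda>(x, y). Complex x y) -` box l u \<inter> space (lborel \<Otimes>\<^sub>M lborel)
      = box (Re l) (Re u) \<times> box (Im l) (Im u)"
    by (auto simp: box_def Basis_complex_def space_pair_measure)
  then show "emeasure (distr (lborel \<Otimes>\<^sub>M lborel) borel (\<lambda>(x, y). Complex x y)) (box l u)
      = ennreal (\<Prod>b\<in>Basis. (u - l) \<bullet> b)"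
    using le' by (subst emeasure_distr) (auto simp: lborel.emeasure_pair_measure_Times
        Basis_complex_def ennreal_mult box_real)
qed simp

lemma measurable_Complex [measurable (raw)]:
  assumes "f \<in> borel_measurable M" "g \<in> borel_measurable M"
  shows "(\<lambda>x. Complex (f x) (g x)) \<in> borel_measurable M"
  using assms by (simp add: Complex_eq)

text \<open>Both orders are recorded because the vertical and the horizontal sides of a square are
  integrated along different coordinates.\<close>

lemma nn_integral_complex:
  assumes [measurable]: "h \<in> borel_measurable borel"
  shows "(\<integral>\<^sup>+z. h z \<partial>lborel) = (\<integral>\<^sup>+x. \<integral>\<^sup>+y. h (Complex x y) \<partial>lborel \<partial>lborel)"
    and "(\<integral>\<^sup>+z. h z \<partial>lborel) = (\<integral>\<^sup>+y. \<integral>\<^sup>+x. h (Complex x y) \<partial>lborel \<partial>lborel)"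
proof -
  have [measurable]: "(\<lambda>(x, y). h (Complex x y)) \<in> borel_measurable (lborel \<Otimes>\<^sub>M lborel)"
    by measurable
  have "(\<integral>\<^sup>+z. h z \<partial>lborel) = (\<integral>\<^sup>+w. h (case w of (x, y) \<Rightarrow> Complex x y) \<partial>(lborel \<Otimes>\<^sub>M lborel))"
    unfolding lborel_complex_eq by (subst nn_integral_distr) auto
  also have "\<dots> = (\<integral>\<^sup>+w. (case w of (x, y) \<Rightarrow> h (Complex x y)) \<partial>(lborel \<Otimes>\<^sub>M lborel))"
    by (simp add: split_beta')
  finally have eq: "(\<integral>\<^sup>+z. h z \<partial>lborel) = (\<integral>\<^sup>+w. (case w of (x, y) \<Rightarrow> h (Complex x y)) \<partial>(lborel \<Otimes>\<^sub>M lborel))" .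
  show *: "(\<integral>\<^sup>+z. h z \<partial>lborel) = (\<integral>\<^sup>+x. \<integral>\<^sup>+y. h (Complex x y) \<partial>lborel \<partial>lborel)"
    unfolding eq by (subst lborel.nn_integral_fst[symmetric]) auto
  show "(\<integral>\<^sup>+z. h z \<partial>lborel) = (\<integral>\<^sup>+y. \<integral>\<^sup>+x. h (Complex x y) \<partial>lborel \<partial>lborel)"
    unfolding * by (rule lborel_pair.Fubini'[symmetric]) measurable
qed

section \<open>Mean value inequalities on squares\<close>

text \<open>Arc length measured from the midpoint makes all four sides of a square integrals over
  the same interval. Values in \<open>ennreal\<close> spare integrability conditions when squares of
  different sizes are averaged.\<close>

lemma norm_contour_integral_linepath_le:
  fixes f :: "complex \<Rightarrow> complex"
  assumes r: "0 < r" and d: "cmod d = 1"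
    and cont: "continuous_on (closed_segment (c - r *\<^sub>R d) (c + r *\<^sub>R d)) f"
  shows "ennreal (cmod (contour_integral (linepath (c - r *\<^sub>R d) (c + r *\<^sub>R d)) f))
    \<le> (\<integral>\<^sup>+t. ennreal (cmod (f (c + t *\<^sub>R d))) * indicator {-r..r} t \<partial>lborel)"
proof -
  let ?a = "c - r *\<^sub>R d" and ?b = "c + r *\<^sub>R d"
  have cont': "continuous_on {0..1} (\<lambda>t. f (linepath ?a ?b t))"
    by (rule continuous_on_compose2[OF cont]) (auto simp: linepath_in_path continuous_on_linepath)
  have lp: "linepath ?a ?b t = c + (2 * r * t - r) *\<^sub>R d" for t
    by (simp add: linepath_def scaleR_conv_of_real algebra_simps)
  have "contour_integral (linepath ?a ?b) f = (?b - ?a) * integral {0..1} (\<lambda>t. f (linepath ?a ?b t))"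
    by (simp add: contour_integral_integral)
  then have "cmod (contour_integral (linepath ?a ?b) f)
      = 2 * r * cmod (integral {0..1} (\<lambda>t. f (linepath ?a ?b t)))"
    using r d by (simp add: norm_mult flip: scaleR_2)
  also have "\<dots> \<le> 2 * r * integral {0..1} (\<lambda>t. cmod (f (linepath ?a ?b t)))"
    using r cont' by (intro mult_left_mono integral_norm_bound_integral integrable_continuous_interval
        continuous_on_norm) auto
  finally have "ennreal (cmod (contour_integral (linepath ?a ?b) f))
      \<le> ennreal (2 * r) * ennreal (integral {0..1} (\<lambda>t. cmod (f (linepath ?a ?b t))))"
    using r by (simp add: ennreal_mult'[symmetric] ennreal_leI)
  also have "ennreal (integral {0..1} (\<lambda>t. cmod (f (linepath ?a ?b t))))
      = (\<integral>\<^sup>+t\<in>{0..1}. ennreal (cmod (f (linepath ?a ?b t))) \<partial>lborel)"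
    by (rule nn_integral_has_integral_lebesgue'[symmetric])
      (auto intro!: integrable_integral integrable_continuous_interval continuous_on_norm cont')
  also have "ennreal (2 * r) * \<dots>
      = (\<integral>\<^sup>+t. ennreal (cmod (f (c + t *\<^sub>R d))) * indicator {-r..r} t \<partial>lborel)"
  proof -
    let ?h = "\<lambda>t. ennreal (cmod (f (c + t *\<^sub>R d))) * indicator {-r..r} t"
    have ce: "continuous_on {-r..r} (\<lambda>t. f (c + t *\<^sub>R d))"
    proof (rule continuous_on_compose2[OF cont])
      show "(\<lambda>t. c + t *\<^sub>R d) ` {-r..r} \<subseteq> closed_segment ?a ?b"
      proof (clarify)
        fix t assume "t \<in> {-r..r}"
        then show "c + t *\<^sub>R d \<in> closed_segment ?a ?b"
          using r lp[of "(t + r) / (2 * r)"] linepath_in_path[of "(t + r) / (2 * r)" ?a ?b] by simp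
      qed
    qed (intro continuous_intros)
    have "(\<lambda>t. indicator {-r..r} t *\<^sub>R cmod (f (c + t *\<^sub>R d))) \<in> borel_measurable borel"
      by (intro borel_measurable_continuous_on_indicator continuous_on_norm ce) auto
    then have "(\<lambda>t. ennreal (indicator {-r..r} t *\<^sub>R cmod (f (c + t *\<^sub>R d)))) \<in> borel_measurable borel"
      by (rule measurable_compose) simp
    also have "(\<lambda>t. ennreal (indicator {-r..r} t *\<^sub>R cmod (f (c + t *\<^sub>R d)))) = ?h"
      by (auto simp: fun_eq_iff split: split_indicator)
    finally have "(\<integral>\<^sup>+t. ?h t \<partial>lborel) = ennreal \<bar>2 * r\<bar> * (\<integral>\<^sup>+t. ?h (- r + 2 * r * t) \<partial>lborel)"
      using r by (intro nn_integral_real_affine) auto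
    also have "(\<integral>\<^sup>+t. ?h (- r + 2 * r * t) \<partial>lborel)
        = (\<integral>\<^sup>+t\<in>{0..1}. ennreal (cmod (f (linepath ?a ?b t))) \<partial>lborel)"
    proof (rule nn_integral_cong)
      fix t
      have "2 * r * t \<le> 2 * r \<longleftrightarrow> t \<le> 1" "0 \<le> 2 * r * t \<longleftrightarrow> 0 \<le> t" using r by (auto simp: zero_le_mult_iff)
      then have "- r + 2 * r * t \<in> {-r..r} \<longleftrightarrow> t \<in> {0..1}" by auto
      then show "?h (- r + 2 * r * t) = ennreal (cmod (f (linepath ?a ?b t))) * indicator {0..1} t"
        by (auto simp: lp indicator_def)
    qed
    finally show ?thesis using r by simp
  qed
  finally show ?thesis .
qed


text \<open>Squares take the place of discs because their sides are parallel to the axes: averaging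
  over the size then needs only Fubini in Cartesian coordinates. The parameter \<open>R\<close> is
  half the side length.\<close>

definition open_square :: "complex \<Rightarrow> real \<Rightarrow> complex set" where
  "open_square z R = {w. \<bar>Re w - Re z\<bar> < R \<and> \<bar>Im w - Im z\<bar> < R}"

lemma open_square_eq_box: "open_square z R = box (z - Complex R R) (z + Complex R R)"
  by (auto simp: open_square_def box_def Basis_complex_def abs_less_iff)

lemma open_open_square [simp]: "open (open_square z R)"
  by (simp add: open_square_eq_box open_box)

lemma emeasure_open_square: "0 < R \<Longrightarrow> emeasure lborel (open_square z R) = ennreal (4 * R\<^sup>2)"
  unfolding open_square_eq_box
  by (subst emeasure_lborel_box) (auto simp: Basis_complex_def power2_eq_square ennreal_mult'[symmetric])

text \<open>Cauchy's integral formula with the kernel estimated by the distance from the centre to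
  the boundary. The reversed parameter on the top and left sides follows the counterclockwise
  orientation; reflection removes it later.\<close>

lemma cauchy_square:
  assumes f: "f holomorphic_on open_square z R" and r: "0 < r" "r < R"
  shows "ennreal (2 * pi * r * cmod (f z))
    \<le> (\<integral>\<^sup>+t. ennreal (cmod (f (z + Complex t (-r)))) * indicator {-r..r} t \<partial>lborel)
     + (\<integral>\<^sup>+t. ennreal (cmod (f (z + Complex r t))) * indicator {-r..r} t \<partial>lborel)
     + (\<integral>\<^sup>+t. ennreal (cmod (f (z + Complex (-t) r))) * indicator {-r..r} t \<partial>lborel)
     + (\<integral>\<^sup>+t. ennreal (cmod (f (z + Complex (-r) (-t)))) * indicator {-r..r} t \<partial>lborel)"
proof -
  \<comment> \<open>The factor \<open>r\<close> normalises the kernel: boundary points have distance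
    at least \<open>r\<close> from \<open>z\<close>, so |g| \<le> |f| there.\<close>
  define g where "g w = of_real r * f w / (w - z)" for w
  define a1 a2 a3 a4 where "a1 = z + Complex (-r) (-r)" and "a2 = z + Complex r (-r)"
    and "a3 = z + Complex r r" and "a4 = z + Complex (-r) r"
  have zin: "z \<in> open_square z R" using r by (simp add: open_square_def)
  have convex: "convex (open_square z R)" by (simp add: open_square_eq_box)
  have rect: "rectpath a1 a3 = linepath a1 a2 +++ linepath a2 a3 +++ linepath a3 a4 +++ linepath a4 a1"
  proof -
    have "a2 = Complex (Re a3) (Im a1)" "a4 = Complex (Re a1) (Im a3)"
      by (simp_all add: a1_def a2_def a3_def a4_def complex_eq_iff)
    then show ?thesis by (simp add: rectpath_def Let_def)
  qed
  have img: "path_image (rectpath a1 a3) \<subseteq> open_square z R - {z}"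
    using r by (subst path_image_rectpath) (auto simp: a1_def a3_def open_square_def)
  have wind: "winding_number (rectpath a1 a3) z = 1"
    using r by (intro winding_number_rectpath) (auto simp: a1_def a3_def box_def Basis_complex_def)
  have "((\<lambda>w. of_real r * f w / (w - z)) has_contour_integral
      (2 * pi * \<i> * winding_number (rectpath a1 a3) z * (of_real r * f z))) (rectpath a1 a3)"
    using r by (intro Cauchy_integral_formula_convex_simple[OF convex] holomorphic_intros f img)
      (auto simp: interior_open zin)
  then have c0: "contour_integral (rectpath a1 a3) g = 2 * pi * \<i> * of_real r * f z"
    unfolding g_def[abs_def] by (simp add: wind contour_integral_unique)
  have contg: "continuous_on (path_image (rectpath a1 a3)) g"
    unfolding g_def using img
    by (intro continuous_intros continuous_on_subset[OF holomorphic_on_imp_continuous_on[OF f]]) auto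
  have sub: "closed_segment a1 a2 \<subseteq> path_image (rectpath a1 a3)"
    "closed_segment a2 a3 \<subseteq> path_image (rectpath a1 a3)"
    "closed_segment a3 a4 \<subseteq> path_image (rectpath a1 a3)"
    "closed_segment a4 a1 \<subseteq> path_image (rectpath a1 a3)"
    unfolding rect by (auto simp: path_image_join)
  note cs = continuous_on_subset[OF contg sub(1)] continuous_on_subset[OF contg sub(2)]
    continuous_on_subset[OF contg sub(3)] continuous_on_subset[OF contg sub(4)]
  note ci = cs[THEN contour_integrable_continuous_linepath]
  have "contour_integral (rectpath a1 a3) g = contour_integral (linepath a1 a2) g
      + (contour_integral (linepath a2 a3) g + (contour_integral (linepath a3 a4) g
      + contour_integral (linepath a4 a1) g))"
    unfolding rect using ci by (simp add: contour_integrable_join)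
  then have "cmod (2 * pi * \<i> * of_real r * f z) \<le> cmod (contour_integral (linepath a1 a2) g)
      + cmod (contour_integral (linepath a2 a3) g) + cmod (contour_integral (linepath a3 a4) g)
      + cmod (contour_integral (linepath a4 a1) g)"
    unfolding c0 by (metis (no_types, lifting) add.assoc add_left_mono norm_triangle_ineq norm_triangle_le)
  then have "ennreal (2 * pi * r * cmod (f z)) \<le> ennreal (cmod (contour_integral (linepath a1 a2) g))
      + ennreal (cmod (contour_integral (linepath a2 a3) g))
      + ennreal (cmod (contour_integral (linepath a3 a4) g))
      + ennreal (cmod (contour_integral (linepath a4 a1) g))"
    using r by (simp add: norm_mult ennreal_plus[symmetric] ennreal_leI del: ennreal_plus)
  moreover have side: "ennreal (cmod (contour_integral (linepath a b) g))
      \<le> (\<integral>\<^sup>+t. ennreal (cmod (f (z + e t))) * indicator {-r..r} t \<partial>lborel)"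
    if "continuous_on (closed_segment a b) g" "cmod d = 1"
      "\<And>t. z + e t = c + t *\<^sub>R d" "a = c - r *\<^sub>R d" "b = c + r *\<^sub>R d"
      "\<And>t. r \<le> cmod (e t)" for a b c d e
  proof -
    have "ennreal (cmod (contour_integral (linepath a b) g))
        \<le> (\<integral>\<^sup>+t. ennreal (cmod (g (z + e t))) * indicator {-r..r} t \<partial>lborel)"
      using norm_contour_integral_linepath_le[of r d c g] that(1,2) r
      unfolding that(3) that(4,5)[symmetric] by simp
    also have "\<dots> \<le> (\<integral>\<^sup>+t. ennreal (cmod (f (z + e t))) * indicator {-r..r} t \<partial>lborel)"
    proof (intro nn_integral_mono mult_right_mono ennreal_leI)
      fix t
      have "cmod (g (z + e t)) = r * cmod (f (z + e t)) / cmod (e t)"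
        using r by (simp add: g_def norm_mult norm_divide)
      also have "\<dots> \<le> cmod (f (z + e t))"
        using mult_right_mono[OF that(6)[of t], of "cmod (f (z + e t))"] that(6)[of t] r
        by (subst pos_divide_le_eq) (auto simp: mult.commute)
      finally show "cmod (g (z + e t)) \<le> cmod (f (z + e t))" .
    qed auto
    finally show ?thesis .
  qed
  moreover have "ennreal (cmod (contour_integral (linepath a1 a2) g))
      \<le> (\<integral>\<^sup>+t. ennreal (cmod (f (z + Complex t (-r)))) * indicator {-r..r} t \<partial>lborel)"
  proof (rule side[of _ _ "1" _ "z + Complex 0 (-r)"])
    show "r \<le> cmod (Complex t (-r))" for t
      using abs_Im_le_cmod[of "Complex t (-r)"] r by simp
  qed (use cs(1) in \<open>simp_all add: a1_def a2_def complex_eq_iff\<close>)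
  moreover have "ennreal (cmod (contour_integral (linepath a2 a3) g))
      \<le> (\<integral>\<^sup>+t. ennreal (cmod (f (z + Complex r t))) * indicator {-r..r} t \<partial>lborel)"
  proof (rule side[of _ _ "\<i>" _ "z + Complex r 0"])
    show "r \<le> cmod (Complex r t)" for t
      using abs_Re_le_cmod[of "Complex r t"] r by simp
  qed (use cs(2) in \<open>simp_all add: a2_def a3_def complex_eq_iff\<close>)
  moreover have "ennreal (cmod (contour_integral (linepath a3 a4) g))
      \<le> (\<integral>\<^sup>+t. ennreal (cmod (f (z + Complex (-t) r))) * indicator {-r..r} t \<partial>lborel)"
  proof (rule side[of _ _ "-1" _ "z + Complex 0 r"])
    show "r \<le> cmod (Complex (-t) r)" for t
      using abs_Im_le_cmod[of "Complex (-t) r"] r by simp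
  qed (use cs(3) in \<open>simp_all add: a3_def a4_def complex_eq_iff\<close>)
  moreover have "ennreal (cmod (contour_integral (linepath a4 a1) g))
      \<le> (\<integral>\<^sup>+t. ennreal (cmod (f (z + Complex (-r) (-t)))) * indicator {-r..r} t \<partial>lborel)"
  proof (rule side[of _ _ "-\<i>" _ "z + Complex (-r) 0"])
    show "r \<le> cmod (Complex (-r) (-t))" for t
      using abs_Re_le_cmod[of "Complex (-r) (-t)"] r by simp
  qed (use cs(4) in \<open>simp_all add: a4_def a1_def complex_eq_iff\<close>)
  ultimately show ?thesis
    by (meson add_mono order_trans)
qed


lemma borel_measurable_norm_on_open:
  assumes "continuous_on A f" "open A"
  shows "(\<lambda>w. ennreal (norm (f w) powr p) * indicator A w) \<in> borel_measurable borel"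
proof -
  have "(\<lambda>w. indicator A w *\<^sub>R f w) \<in> borel_measurable borel"
    using assms by (intro borel_measurable_continuous_on_indicator) auto
  then have "(\<lambda>w. ennreal (norm (indicator A w *\<^sub>R f w) powr p) * indicator A w) \<in> borel_measurable borel"
    using borel_open[OF assms(2)] by measurable
  also have "(\<lambda>w. ennreal (norm (indicator A w *\<^sub>R f w) powr p) * indicator A w)
      = (\<lambda>w. ennreal (norm (f w) powr p) * indicator A w)"
    by (auto simp: fun_eq_iff split: split_indicator)
  finally show ?thesis .
qed

lemma nn_integral_lborel_reflect:
  fixes h :: "real \<Rightarrow> ennreal"
  assumes "h \<in> borel_measurable borel"
  shows "(\<integral>\<^sup>+t. h (- t) \<partial>lborel) = (\<integral>\<^sup>+t. h t \<partial>lborel)"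
  using nn_integral_real_affine[OF assms, of "-1" 0] by simp

text \<open>The Cauchy estimate is integrated over the size of concentric squares. Each of the four
  sides sweeps out a part of the square, and bounding each part by the whole integral costs the
  factor 4.\<close>

lemma area_mean_value:
  assumes f: "f holomorphic_on open_square z R" and R: "0 < R"
  shows "ennreal (R\<^sup>2 * cmod (f z)) \<le> 4 * (\<integral>\<^sup>+w\<in>open_square z R. ennreal (cmod (f w)) \<partial>lborel)"
proof -
  \<comment> \<open>Extension by zero: \<open>f\<close> is controlled on the square only, whereas
    Fubini needs a function measurable on the plane.\<close>
  define k where "k w = ennreal (cmod (f w)) * indicator (open_square z R) w" for w
  have km [measurable]: "k \<in> borel_measurable borel"
    using borel_measurable_norm_on_open[OF holomorphic_on_imp_continuous_on[OF f], of 1]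
    by (simp add: k_def[abs_def])
  define h where "h w = k (z + w)" for w
  have [measurable]: "h \<in> borel_measurable borel"
    unfolding h_def by measurable
  define A where "A x = (\<integral>\<^sup>+t. h (Complex x t) \<partial>lborel)" for x
  define B where "B x = (\<integral>\<^sup>+t. h (Complex t x) \<partial>lborel)" for x
  have Am [measurable]: "A \<in> borel_measurable borel" "B \<in> borel_measurable borel"
    unfolding A_def B_def by measurable
  have trans: "(\<integral>\<^sup>+w. h w \<partial>lborel) = (\<integral>\<^sup>+w. k w \<partial>lborel)"
  proof -
    have "(\<integral>\<^sup>+w. k w \<partial>lborel) = (\<integral>\<^sup>+w. k w \<partial>(distr lborel borel ((+) z)))"
      by (simp add: lborel_distr_plus)
    also have "\<dots> = (\<integral>\<^sup>+w. h w \<partial>lborel)"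
      by (subst nn_integral_distr) (auto simp: h_def[abs_def])
    finally show ?thesis by simp
  qed
  have le: "ennreal (cmod (f (z + w))) * indicator {-r..r} t \<le> h w"
    if "r < R" "Re w \<in> {t, -t, r, -r}" "Im w \<in> {t, -t, r, -r}" for r t w
    using that by (auto simp: h_def k_def open_square_def split: split_indicator)
  have AB: "ennreal (2 * pi * r * cmod (f z)) \<le> A r + A (-r) + B r + B (-r)"
    if r: "0 < r" "r < R" for r
  proof -
    have b1: "(\<integral>\<^sup>+t. ennreal (cmod (f (z + Complex t (-r)))) * indicator {-r..r} t \<partial>lborel) \<le> B (-r)"
      unfolding B_def using r by (intro nn_integral_mono le) auto
    have b2: "(\<integral>\<^sup>+t. ennreal (cmod (f (z + Complex r t))) * indicator {-r..r} t \<partial>lborel) \<le> A r"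
      unfolding A_def using r by (intro nn_integral_mono le) auto
    have "(\<integral>\<^sup>+t. ennreal (cmod (f (z + Complex (-t) r))) * indicator {-r..r} t \<partial>lborel)
        \<le> (\<integral>\<^sup>+t. h (Complex (-t) r) \<partial>lborel)"
      using r by (intro nn_integral_mono le) auto
    also have "\<dots> = B r"
      unfolding B_def by (rule nn_integral_lborel_reflect) measurable
    finally have b3: "(\<integral>\<^sup>+t. ennreal (cmod (f (z + Complex (-t) r))) * indicator {-r..r} t \<partial>lborel) \<le> B r" .
    have "(\<integral>\<^sup>+t. ennreal (cmod (f (z + Complex (-r) (-t)))) * indicator {-r..r} t \<partial>lborel)
        \<le> (\<integral>\<^sup>+t. h (Complex (-r) (-t)) \<partial>lborel)"
      using r by (intro nn_integral_mono le) auto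
    also have "\<dots> = A (-r)"
      unfolding A_def by (rule nn_integral_lborel_reflect) measurable
    finally have b4: "(\<integral>\<^sup>+t. ennreal (cmod (f (z + Complex (-r) (-t)))) * indicator {-r..r} t \<partial>lborel) \<le> A (-r)" .
    have "ennreal (2 * pi * r * cmod (f z)) \<le> B (-r) + A r + B r + A (-r)"
      by (rule order_trans[OF cauchy_square[OF f r] add_mono[OF add_mono[OF add_mono[OF b1 b2] b3] b4]])
    then show ?thesis by (simp add: ac_simps)
  qed
  \<comment> \<open>Only half-sides between R/2 and R are used, where 2 pi r \<ge> pi R. The
    interval has length R/2, and pi/2 \<ge> 1 disposes of the constant.\<close>
  have "ennreal (R\<^sup>2 * cmod (f z)) \<le> ennreal (pi * R * cmod (f z)) * ennreal (R / 2)"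
  proof -
    have "R * R * cmod (f z) * 2 \<le> R * R * cmod (f z) * pi"
      using pi_gt3 by (intro mult_left_mono) auto
    then show ?thesis
      using R by (simp add: ennreal_mult'[symmetric] power2_eq_square ennreal_leI algebra_simps)
  qed
  also have "\<dots> = (\<integral>\<^sup>+r\<in>{R/2<..<R}. ennreal (pi * R * cmod (f z)) \<partial>lborel)"
    using R by (simp add: nn_integral_cmult_indicator)
  also have "\<dots> \<le> (\<integral>\<^sup>+r. A r + A (-r) + B r + B (-r) \<partial>lborel)"
  proof (rule nn_integral_mono)
    fix r
    show "ennreal (pi * R * cmod (f z)) * indicator {R/2<..<R} r \<le> A r + A (-r) + B r + B (-r)"
    proof (cases "r \<in> {R/2<..<R}")
      case True
      then have "pi * R * cmod (f z) \<le> 2 * pi * r * cmod (f z)"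
        by (intro mult_right_mono) auto
      then have "ennreal (pi * R * cmod (f z)) \<le> ennreal (2 * pi * r * cmod (f z))"
        by (rule ennreal_leI)
      also have "\<dots> \<le> A r + A (-r) + B r + B (-r)" using True R by (intro AB) auto
      finally show ?thesis using True by simp
    qed simp
  qed
  also have "\<dots> = (\<integral>\<^sup>+r. A r \<partial>lborel) + (\<integral>\<^sup>+r. A (-r) \<partial>lborel) + (\<integral>\<^sup>+r. B r \<partial>lborel) + (\<integral>\<^sup>+r. B (-r) \<partial>lborel)"
    by (simp add: nn_integral_add)
  also have "\<dots> = 4 * (\<integral>\<^sup>+w. h w \<partial>lborel)"
  proof -
    have "(\<integral>\<^sup>+r. A r \<partial>lborel) = (\<integral>\<^sup>+w. h w \<partial>lborel)"
      unfolding A_def by (rule nn_integral_complex(1)[symmetric]) measurable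
    moreover have "(\<integral>\<^sup>+r. B r \<partial>lborel) = (\<integral>\<^sup>+w. h w \<partial>lborel)"
      unfolding B_def by (rule nn_integral_complex(2)[symmetric]) measurable
    moreover have "x + x + x + x = 4 * x" for x :: ennreal
      by (metis (no_types, lifting) add.assoc mult_2 numeral_Bit0 distrib_right)
    ultimately show ?thesis using Am by (simp add: nn_integral_lborel_reflect)
  qed
  finally show ?thesis unfolding trans k_def .
qed

text \<open>A threshold argument replaces Hoelder's inequality: the part of the mean where |f| is at
  most |f z|/32 is absorbed, and on the rest |f| |f z|^(p-1) is bounded by a multiple of
  |f|^p.\<close>

lemma area_mean_value_powr:
  assumes f: "f holomorphic_on open_square z R" and R: "0 < R" and p: "1 \<le> p"
  shows "ennreal (R\<^sup>2 * cmod (f z) powr p)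
    \<le> ennreal (8 * 32 powr (p - 1)) * (\<integral>\<^sup>+w\<in>open_square z R. ennreal (cmod (f w) powr p) \<partial>lborel)"
proof (cases "f z = 0")
  case False
  define a where "a = cmod (f z)"
  have a: "0 < a" using False by (simp add: a_def)
  let ?I = "\<lambda>w. indicator (open_square z R) w :: ennreal"
  define J where "J = (\<integral>\<^sup>+w. ennreal (cmod (f w) powr p) * ?I w \<partial>lborel)"
  note m = borel_measurable_norm_on_open[OF holomorphic_on_imp_continuous_on[OF f] open_open_square]
  \<comment> \<open>The number 32 is fixed by the absorption: the factor 4 of
    \<open>area_mean_value\<close> and the area 4 R^2 turn a^p/32 into half of the left-hand side
    R^2 a^p.\<close>
  have young: "x * a powr (p - 1) \<le> a powr p / 32 + 32 powr (p - 1) * x powr p" if "0 \<le> x" for x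
  proof (cases "x \<le> a / 32")
    case True
    then have "x * a powr (p - 1) \<le> a / 32 * a powr (p - 1)" by (intro mult_right_mono) auto
    also have "\<dots> = a powr p / 32" using a by (simp add: powr_diff)
    finally show ?thesis by (rule order_trans) (simp add: that)
  next
    case xa: False
    then have "x * a powr (p - 1) \<le> x * (32 * x) powr (p - 1)"
      using a p that by (intro mult_left_mono powr_mono2) auto
    also have "\<dots> = 32 powr (p - 1) * x powr p"
      using xa a that by (simp add: powr_mult powr_diff)
    finally show ?thesis by (rule order_trans) simp
  qed
  have "ennreal (R\<^sup>2 * a powr p) = ennreal (a powr (p - 1)) * ennreal (R\<^sup>2 * a)"
    using a by (simp add: ennreal_mult'[symmetric] powr_diff)
  also have "\<dots> \<le> ennreal (a powr (p - 1)) * (4 * (\<integral>\<^sup>+w. ennreal (cmod (f w)) * ?I w \<partial>lborel))"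
    unfolding a_def by (intro mult_left_mono area_mean_value f R) auto
  also have "\<dots> = 4 * (\<integral>\<^sup>+w. ennreal (a powr (p - 1)) * (ennreal (cmod (f w)) * ?I w) \<partial>lborel)"
    using m[of 1] by (subst nn_integral_cmult) (auto simp: mult_ac)
  also have "\<dots> \<le> 4 * (\<integral>\<^sup>+w. ennreal (a powr p / 32) * ?I w
      + ennreal (32 powr (p - 1)) * (ennreal (cmod (f w) powr p) * ?I w) \<partial>lborel)"
  proof (intro mult_left_mono nn_integral_mono)
    fix w
    have "ennreal (a powr (p - 1)) * ennreal (cmod (f w))
        \<le> ennreal (a powr p / 32) + ennreal (32 powr (p - 1)) * ennreal (cmod (f w) powr p)"
      using young[of "cmod (f w)"]
      by (simp add: ennreal_mult'[symmetric] ennreal_plus[symmetric] ennreal_leI mult.commute del: ennreal_plus)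
    then show "ennreal (a powr (p - 1)) * (ennreal (cmod (f w)) * ?I w) \<le> ennreal (a powr p / 32) * ?I w
      + ennreal (32 powr (p - 1)) * (ennreal (cmod (f w) powr p) * ?I w)"
      by (auto split: split_indicator)
  qed auto
  also have "\<dots> = 4 * (ennreal (a powr p / 32) * ennreal (4 * R\<^sup>2) + ennreal (32 powr (p - 1)) * J)"
    using m[of p] R by (subst nn_integral_add)
      (auto simp: nn_integral_cmult nn_integral_cmult_indicator emeasure_open_square J_def)
  also have "\<dots> = ennreal (R\<^sup>2 * a powr p / 2) + ennreal (4 * 32 powr (p - 1)) * J"
  proof -
    have "4 * (ennreal (a powr p / 32) * ennreal (4 * R\<^sup>2)) = ennreal (4 * (a powr p / 32 * (4 * R\<^sup>2)))"
      by (subst ennreal_mult'[symmetric], simp, subst ennreal_mult', auto)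
    moreover have "4 * (ennreal (32 powr (p - 1)) * J) = ennreal (4 * 32 powr (p - 1)) * J"
      by (simp add: ennreal_mult' mult.assoc)
    ultimately show ?thesis by (simp add: distrib_left mult_ac)
  qed
  finally have main: "ennreal (R\<^sup>2 * a powr p) \<le> ennreal (R\<^sup>2 * a powr p / 2) + ennreal (4 * 32 powr (p - 1)) * J" .
  have "ennreal (R\<^sup>2 * a powr p) \<le> ennreal (8 * 32 powr (p - 1)) * J"
  proof (cases J rule: ennreal_cases)
    case (real j)
    then have "R\<^sup>2 * a powr p \<le> R\<^sup>2 * a powr p / 2 + 4 * 32 powr (p - 1) * j"
      using main by (simp add: ennreal_mult'[symmetric] ennreal_plus[symmetric] del: ennreal_plus)
    then show ?thesis using real by (simp add: ennreal_mult'[symmetric] ennreal_leI)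
  qed (simp add: ennreal_mult_top)
  then show ?thesis by (simp add: a_def J_def)
qed simp

section \<open>Decay at infinity of functions of finite norm\<close>

lemma Delta2_sigma_finite:
  assumes M: "borel_measure_on {0..} M" and D: "Delta2 M"
  shows "sigma_finite_measure M"
proof
  have sp: "space M = {0..}"
    using sets_eq_imp_space_eq[OF M[unfolded borel_measure_on_def]] by (simp add: space_restrict_space)
  let ?A = "range (\<lambda>n::nat. {0..<real (Suc n)})"
  have "?A \<subseteq> sets M"
  proof clarify
    fix n :: nat
    show "{0..<real (Suc n)} \<in> sets M"
      unfolding M[unfolded borel_measure_on_def] by (subst sets_restrict_space_iff) auto
  qed
  moreover have "\<Union> ?A = space M"
  proof -
    have "\<exists>n. x < real (Suc n)" for x :: real
      using reals_Archimedean2[of x] by (metis less_trans lessI of_nat_less_iff)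
    then show ?thesis unfolding sp by (fastforce simp del: of_nat_Suc)
  qed
  moreover have "\<forall>a\<in>?A. emeasure M a \<noteq> \<infinity>"
    using D by (auto simp: Delta2_def less_top simp del: of_nat_Suc)
  ultimately show "\<exists>A. countable A \<and> A \<subseteq> sets M \<and> \<Union> A = space M \<and> (\<forall>a\<in>A. emeasure M a \<noteq> \<infinity>)"
    by (intro exI[of _ ?A] conjI countable_image countableI_type)
qed

lemma nn_integral_half_plane_measure:
  fixes M :: "real measure"
  assumes M: "borel_measure_on {0..} M" and [measurable]: "h \<in> borel_measurable borel"
  shows "(\<integral>\<^sup>+z. h z \<partial>half_plane_measure M) = (\<integral>\<^sup>+x. \<integral>\<^sup>+y. h (Complex x y) \<partial>lborel \<partial>M)"
proof -
  have s: "sets M = sets (restrict_space borel {0..})" using M by (simp add: borel_measure_on_def)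
  have sp: "space M = {0..}" using sets_eq_imp_space_eq[OF s] by (simp add: space_restrict_space)
  have id: "(\<lambda>x. x) \<in> borel_measurable M"
    unfolding measurable_cong_sets[OF s refl] by (rule measurable_restrict_space1) simp
  have [measurable]: "fst \<in> borel_measurable (M \<Otimes>\<^sub>M lborel)"
    by (rule measurable_compose[OF measurable_fst id])
  have c: "(\<lambda>(x, y). Complex x y) \<in> borel_measurable (M \<Otimes>\<^sub>M lborel)"
    unfolding split_beta' by measurable
  then have T: "(\<lambda>(x, y). Complex x y) \<in> M \<Otimes>\<^sub>M lborel \<rightarrow>\<^sub>M restrict_space borel closed_right_half_plane"
    by (intro measurable_restrict_space2)
      (auto simp: space_pair_measure sp closed_right_half_plane_def)
  have hr: "h \<in> borel_measurable (restrict_space borel closed_right_half_plane)"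
    by (rule measurable_restrict_space1) measurable
  have "(\<integral>\<^sup>+z. h z \<partial>half_plane_measure M) = (\<integral>\<^sup>+w. h (case w of (x, y) \<Rightarrow> Complex x y) \<partial>(M \<Otimes>\<^sub>M lborel))"
    unfolding half_plane_measure_def by (subst nn_integral_distr[OF T]) (use hr in auto)
  also have "\<dots> = (\<integral>\<^sup>+w. (case w of (x, y) \<Rightarrow> h (Complex x y)) \<partial>(M \<Otimes>\<^sub>M lborel))"
    by (simp add: split_beta')
  also have "\<dots> = (\<integral>\<^sup>+x. \<integral>\<^sup>+y. h (Complex x y) \<partial>lborel \<partial>M)"
    using measurable_compose[OF c assms(2)]
    by (subst lborel.nn_integral_fst[symmetric]) (auto simp: split_beta')
  finally show ?thesis .
qed

text \<open>For x in [0,1) the translate of (a,b) by x contains (a+1,b). So the strip integral is at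
  most the integral of H(x+\<epsilon>) over \<epsilon> in (a,b) for every such x; integrating over x
  and exchanging the integrals brings in the hypothesis on \<open>V\<close>.\<close>

lemma strip_integral_le:
  fixes M :: "real measure" and H :: "real \<Rightarrow> ennreal"
  assumes M: "borel_measure_on {0..} M" and D: "Delta2 M"
    and [measurable]: "H \<in> borel_measurable borel"
    and V: "\<And>\<epsilon>. 0 < \<epsilon> \<Longrightarrow> (\<integral>\<^sup>+x. H (x + \<epsilon>) \<partial>M) \<le> V"
    and ab: "0 \<le> a" "a \<le> b"
  shows "emeasure M {0..<1} * (\<integral>\<^sup>+s\<in>{a + 1<..<b}. H s \<partial>lborel) \<le> V * ennreal (b - a)"
proof -
  have s: "sets M = sets (restrict_space borel {0..})" using M by (simp add: borel_measure_on_def)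
  interpret M: sigma_finite_measure M using M D by (rule Delta2_sigma_finite)
  interpret P: pair_sigma_finite M lborel ..
  have [measurable]: "(\<lambda>x. x) \<in> borel_measurable M"
    unfolding measurable_cong_sets[OF s refl] by (rule measurable_restrict_space1) simp
  have [measurable]: "{0..<1} \<in> sets M" using s by (auto simp: sets_restrict_space_iff)
  have [measurable]: "fst \<in> borel_measurable (M \<Otimes>\<^sub>M lborel)"
    by (rule measurable_compose[OF measurable_fst, of "\<lambda>x. x"]) measurable
  have inner: "(\<integral>\<^sup>+s\<in>{a + 1<..<b}. H s \<partial>lborel) \<le> (\<integral>\<^sup>+\<epsilon>. H (x + \<epsilon>) * indicator {a<..<b} \<epsilon> \<partial>lborel)"
    if "x \<in> {0..<1}" for x
  proof -
    have "(\<integral>\<^sup>+s\<in>{a + 1<..<b}. H s \<partial>lborel)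
        = (\<integral>\<^sup>+\<epsilon>. H (x + \<epsilon>) * indicator {a + 1<..<b} (x + \<epsilon>) \<partial>lborel)"
      by (subst nn_integral_real_affine[where c = 1 and t = x]) auto
    also have "\<dots> \<le> (\<integral>\<^sup>+\<epsilon>. H (x + \<epsilon>) * indicator {a<..<b} \<epsilon> \<partial>lborel)"
      using that by (intro nn_integral_mono mult_left_mono) (auto split: split_indicator)
    finally show ?thesis .
  qed
  have "emeasure M {0..<1} * (\<integral>\<^sup>+s\<in>{a + 1<..<b}. H s \<partial>lborel)
      = (\<integral>\<^sup>+x. (\<integral>\<^sup>+s\<in>{a + 1<..<b}. H s \<partial>lborel) * indicator {0..<1} x \<partial>M)"
    by (subst nn_integral_cmult_indicator) (simp_all add: mult.commute)
  also have "\<dots> \<le> (\<integral>\<^sup>+x. (\<integral>\<^sup>+\<epsilon>. H (x + \<epsilon>) * indicator {a<..<b} \<epsilon> \<partial>lborel) \<partial>M)"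
    using inner by (intro nn_integral_mono) (auto split: split_indicator)
  also have "\<dots> = (\<integral>\<^sup>+\<epsilon>. (\<integral>\<^sup>+x. H (x + \<epsilon>) * indicator {a<..<b} \<epsilon> \<partial>M) \<partial>lborel)"
    by (rule P.Fubini'[symmetric]) measurable
  also have "\<dots> \<le> (\<integral>\<^sup>+\<epsilon>. V * indicator {a<..<b} \<epsilon> \<partial>lborel)"
    using V ab by (intro nn_integral_mono) (auto split: split_indicator)
  also have "\<dots> = V * ennreal (b - a)"
    using ab by (simp add: nn_integral_cmult_indicator)
  finally show ?thesis .
qed

text \<open>Averaging the definition of the norm over \<open>\<epsilon>\<close> bounds the area integral of \<open>|F|\<^sup>p\<close> over a vertical
  strip by its width, and the mean value property over squares of side proportional to \<open>Re z\<close> turns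
  this into pointwise decay.\<close>

lemma tendsto_0_at_right:
  fixes M :: "real measure"
  assumes M: "borel_measure_on {0..} M" and D: "Delta2 M" and p: "1 \<le> p"
    and F: "F holomorphic_on right_half_plane"
    and fin: "zen_norm_pow p (half_plane_measure M) F < \<infinity>"
  shows "((\<lambda>x. F (Complex x y)) \<longlongrightarrow> 0) at_top"
proof -
  have op: "open right_half_plane"
    unfolding right_half_plane_def by (intro open_Collect_less continuous_intros)
  define h where "h w = ennreal (cmod (F w) powr p) * indicator right_half_plane w" for w
  have hm [measurable]: "h \<in> borel_measurable borel"
    unfolding h_def[abs_def]
    by (rule borel_measurable_norm_on_open[OF holomorphic_on_imp_continuous_on[OF F] op])
  define H where "H s = (\<integral>\<^sup>+y. h (Complex s y) \<partial>lborel)" for s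
  have Hm [measurable]: "H \<in> borel_measurable borel"
    unfolding H_def[abs_def] by measurable
  define V where "V = zen_norm_pow p (half_plane_measure M) F"
  have V: "(\<integral>\<^sup>+x. H (x + \<epsilon>) \<partial>M) \<le> V" if e: "0 < \<epsilon>" for \<epsilon>
  proof -
    have "(\<integral>\<^sup>+x. H (x + \<epsilon>) \<partial>M) = (\<integral>\<^sup>+x. \<integral>\<^sup>+y. h (Complex x y + of_real \<epsilon>) \<partial>lborel \<partial>M)"
      unfolding H_def by (intro nn_integral_cong arg_cong[of _ _ h]) (simp add: complex_eq_iff)
    also have "\<dots> = (\<integral>\<^sup>+z. h (z + of_real \<epsilon>) \<partial>half_plane_measure M)"
      by (rule nn_integral_half_plane_measure[OF M, symmetric]) measurable
    also have "\<dots> = (\<integral>\<^sup>+z. ennreal (cmod (F (z + of_real \<epsilon>)) powr p) \<partial>half_plane_measure M)"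
      using e by (intro nn_integral_cong)
        (auto simp: half_plane_measure_def h_def space_restrict_space right_half_plane_def
          closed_right_half_plane_def)
    also have "\<dots> \<le> V"
      unfolding V_def zen_norm_pow_def using e by (intro SUP_upper) auto
    finally show ?thesis .
  qed
  obtain v where v: "V = ennreal v" "0 \<le> v"
    using fin by (cases V rule: ennreal_cases) (auto simp: V_def)
  obtain n where n: "emeasure M {0..<1} = ennreal n" "0 < n"
  proof -
    have "0 < emeasure M {0..<1}" "emeasure M {0..<1} < \<infinity>"
      using D unfolding Delta2_def by auto
    then show ?thesis using that by (cases "emeasure M {0..<1}" rule: ennreal_cases) auto
  qed
  define K where "K = 8 * 32 powr (p - 1)"
  have K: "0 < K" by (simp add: K_def)
  \<comment> \<open>The strip is that of the square with half-side s/4, written with - 1 and + 1 to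
    fit \<open>strip_integral_le\<close>; s \<ge> 4 keeps 3 s/4 - 1 nonnegative. Its cost grows like
    s and the area of the square like s^2.\<close>
  have bound: "cmod (F (Complex s y)) \<le> (16 * K * v / n * ((s / 2 + 1) / s\<^sup>2)) powr (1 / p)"
    if s: "4 \<le> s" for s
  proof -
    let ?z = "Complex s y" and ?Q = "open_square (Complex s y) (s / 4)"
    have sub: "?Q \<subseteq> right_half_plane" using s
      unfolding open_square_def right_half_plane_def abs_less_iff by (auto simp del: less_divide_eq_numeral1)
    define J where "J = (\<integral>\<^sup>+w\<in>?Q. ennreal (cmod (F w) powr p) \<partial>lborel)"
    have sJ: "ennreal ((s / 4)\<^sup>2 * cmod (F ?z) powr p) \<le> ennreal K * J"
      unfolding J_def K_def using s p
      by (intro area_mean_value_powr holomorphic_on_subset[OF F sub]) auto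
    have "J \<le> (\<integral>\<^sup>+s\<in>{(3 * s / 4 - 1) + 1<..<5 * s / 4}. H s \<partial>lborel)"
    proof -
      have "J \<le> (\<integral>\<^sup>+w. h w * indicator {(3 * s / 4 - 1) + 1<..<5 * s / 4} (Re w) \<partial>lborel)"
        unfolding J_def using s
        by (intro nn_integral_mono) (auto simp: h_def open_square_def right_half_plane_def abs_less_iff
            simp del: less_divide_eq_numeral1 split: split_indicator)
      also have "\<dots> = (\<integral>\<^sup>+x. \<integral>\<^sup>+y. h (Complex x y) * indicator {(3 * s / 4 - 1) + 1<..<5 * s / 4} x \<partial>lborel \<partial>lborel)"
        by (subst nn_integral_complex(1)) auto
      also have "\<dots> = (\<integral>\<^sup>+s\<in>{(3 * s / 4 - 1) + 1<..<5 * s / 4}. H s \<partial>lborel)"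
        unfolding H_def by (intro nn_integral_cong nn_integral_multc) measurable
      finally show ?thesis .
    qed
    then have "ennreal n * J \<le> ennreal n * (\<integral>\<^sup>+s\<in>{(3 * s / 4 - 1) + 1<..<5 * s / 4}. H s \<partial>lborel)"
      by (rule mult_left_mono) auto
    also have "\<dots> \<le> V * ennreal (5 * s / 4 - (3 * s / 4 - 1))"
      unfolding n(1)[symmetric] using s by (intro strip_integral_le[OF M D Hm V]) auto
    also have "\<dots> = ennreal (v * (s / 2 + 1))"
    proof -
      have "5 * s / 4 - (3 * s / 4 - 1) = s / 2 + 1" by simp
      then show ?thesis unfolding v(1) using v(2) by (simp only: ennreal_mult')
    qed
    finally have nJ: "ennreal n * J \<le> ennreal (v * (s / 2 + 1))" .
    have "ennreal (n * ((s / 4)\<^sup>2 * cmod (F ?z) powr p)) \<le> ennreal n * (ennreal K * J)"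
      using sJ n by (subst ennreal_mult') (auto intro: mult_left_mono)
    also have "\<dots> = ennreal K * (ennreal n * J)" by (simp add: ac_simps)
    also have "\<dots> \<le> ennreal K * ennreal (v * (s / 2 + 1))" by (rule mult_left_mono[OF nJ]) simp
    also have "\<dots> = ennreal (K * (v * (s / 2 + 1)))" using K by (simp add: ennreal_mult')
    finally have "n * ((s / 4)\<^sup>2 * cmod (F ?z) powr p) \<le> K * (v * (s / 2 + 1))"
      using K v s by (subst (asm) ennreal_le_iff) auto
    then have "cmod (F ?z) powr p \<le> 16 * K * v / n * ((s / 2 + 1) / s\<^sup>2)"
      using n s by (simp add: field_simps power2_eq_square)
    then have "(cmod (F ?z) powr p) powr (1 / p) \<le> (16 * K * v / n * ((s / 2 + 1) / s\<^sup>2)) powr (1 / p)"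
      using p by (intro powr_mono2) auto
    then show ?thesis using p by (simp add: powr_powr)
  qed
  have "((\<lambda>s::real. (s / 2 + 1) / s\<^sup>2) \<longlongrightarrow> 0) at_top" by real_asymp
  then have "((\<lambda>s. 16 * K * v / n * ((s / 2 + 1) / s\<^sup>2)) \<longlongrightarrow> 16 * K * v / n * 0) at_top"
    by (intro tendsto_mult tendsto_const)
  then have "((\<lambda>s. (16 * K * v / n * ((s / 2 + 1) / s\<^sup>2)) powr (1 / p)) \<longlongrightarrow> 0) at_top"
    using p K v n by (intro tendsto_zero_powrI[where b = "1 / p"])
      (auto intro!: eventually_at_top_linorderI[of 1] mult_nonneg_nonneg divide_nonneg_nonneg)
  then show ?thesis
    by (rule Lim_null_comparison[rotated]) (use bound in \<open>auto intro!: eventually_at_top_linorderI[of 4]\<close>)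
qed

section \<open>Dyadic Carleson squares and their top halves\<close>

definition side :: "int \<Rightarrow> real" where "side j = 2 powi j"

text \<open>Half-open in the imaginary direction, so that cells of one generation are disjoint and
  all cells form a tree. A cell reaches down to the imaginary axis, hence a point lies in a cell of
  every sufficiently large generation.\<close>

definition dyadic_cell :: "int \<times> int \<Rightarrow> complex set" where
  "dyadic_cell = (\<lambda>(j, k). {z. 0 < Re z \<and> Re z < side j \<and>
     of_int k * side j \<le> Im z \<and> Im z < (of_int k + 1) * side j})"

definition cell_centre :: "int \<times> int \<Rightarrow> complex" where
  "cell_centre = (\<lambda>(j, k). Complex (side j / 2) ((of_int k + 1 / 2) * side j))"

text \<open>Closed, so that |F'| attains its maximum and neighbouring generations share the points
  where the pieces of a horizontal ray are joined.\<close>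

definition top_half :: "int \<times> int \<Rightarrow> complex set" where
  "top_half = (\<lambda>(j, k). cbox (Complex (side j / 2) (of_int k * side j))
     (Complex (side j) ((of_int k + 1) * side j)))"

text \<open>The margin of a quarter side leaves room for squares of half-side
  \<open>side j / 4\<close> around every point of the top half.\<close>

definition top_enlarged :: "int \<times> int \<Rightarrow> complex set" where
  "top_enlarged = (\<lambda>(j, k). box (Complex (side j / 4) ((of_int k - 1 / 4) * side j))
     (Complex (5 / 4 * side j) ((of_int k + 5 / 4) * side j)))"

text \<open>For z in the core, heights in the cell differ from Im z by less than 3/4 of the side,
  and Re z is larger than that; so the Carleson square of z contains that of the cell. The bound 7/8
  keeps cores of different generations apart, since 7/16 < 3/4.\<close>

definition top_core :: "int \<times> int \<Rightarrow> complex set" where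
  "top_core = (\<lambda>(j, k). box (Complex (3 / 4 * side j) ((of_int k + 1 / 4) * side j))
     (Complex (7 / 8 * side j) ((of_int k + 3 / 4) * side j)))"

lemma side_pos [simp]: "0 < side j"
  by (simp add: side_def)

lemma side_add_nat: "side (j + int n) = 2 ^ n * side j"
  by (simp add: side_def power_int_add)

lemma side_double: "side (j + 1) = 2 * side j"
  using side_add_nat[of j 1] by simp

lemma side_mono: "i \<le> j \<Longrightarrow> side i \<le> side j"
  by (simp add: side_def power_int_increasing)

lemma side_less_half: "i < j \<Longrightarrow> 2 * side i \<le> side j"
  using side_mono[of "i + 1" j] by (simp add: side_double)

lemma side_unbounded: "\<exists>j\<ge>i. x < side j"
proof -
  obtain n where "x / side i < 2 ^ n" using real_arch_pow[of 2 "x / side i"] by auto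
  then have "x < side (i + int n)" by (simp add: side_add_nat field_simps)
  then show ?thesis by (intro exI[of _ "i + int n"]) auto
qed

lemma side_floor: 
  assumes "0 < x"
  obtains j where "side j / 2 \<le> x" "x < side j"
proof -
  define j where "j = \<lfloor>log 2 x\<rfloor>"
  have "of_int j \<le> log 2 x" "log 2 x < of_int (j + 1)"
    unfolding j_def by linarith+
  then have "2 powr of_int j \<le> x" "x < 2 powr of_int (j + 1)"
    using assms by (simp_all add: le_log_iff log_less_iff del: of_int_add)
  then have "side j \<le> x" "x < side (j + 1)"
    unfolding side_def by (simp_all add: powr_real_of_int' del: of_int_add)
  then show ?thesis using that[of "j + 1"] by (simp add: side_double)
qed

text \<open>In units of \<open>side i\<close> all end points are integers, so the strict
  inequalities given by a common point sharpen by one to the inclusion of the intervals.\<close>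

lemma dyadic_cell_nested:
  assumes ij: "i \<le> j" and z: "z \<in> dyadic_cell (i, l)" "z \<in> dyadic_cell (j, k)"
  shows "of_int k * side j \<le> of_int l * side i" "(of_int l + 1) * side i \<le> (of_int k + 1) * side j"
proof -
  obtain n where "j = i + int n" using ij by (metis zle_iff_zadd)
  then have sj: "side j = 2 ^ n * side i" by (simp add: side_add_nat)
  have "of_int l * side i < (of_int k + 1) * side j" "of_int k * side j < (of_int l + 1) * side i"
    using z by (auto simp: dyadic_cell_def)
  then have "(of_int l :: real) < (of_int k + 1) * 2 ^ n" "of_int k * 2 ^ n < (of_int l :: real) + 1"
    using side_pos[of i] unfolding sj by (simp_all only: mult.assoc[symmetric] mult_less_cancel_right_pos)
  then have "real_of_int l < real_of_int ((k + 1) * 2 ^ n)" "real_of_int (k * 2 ^ n) < real_of_int (l + 1)"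
    by simp_all
  then have "l + 1 \<le> (k + 1) * 2 ^ n" "k * 2 ^ n \<le> l" by linarith+
  then have "real_of_int (l + 1) \<le> real_of_int ((k + 1) * 2 ^ n)" "real_of_int (k * 2 ^ n) \<le> real_of_int l"
    by linarith+
  then have *: "of_int l + 1 \<le> (of_int k + 1) * (2 ^ n :: real)" "of_int k * 2 ^ n \<le> real_of_int l"
    by simp_all
  show "of_int k * side j \<le> of_int l * side i" "(of_int l + 1) * side i \<le> (of_int k + 1) * side j"
    using mult_right_mono[OF *(1) less_imp_le[OF side_pos[of i]]]
      mult_right_mono[OF *(2) less_imp_le[OF side_pos[of i]]]
    unfolding sj by (simp_all only: mult.assoc)
qed

lemma dyadic_cell_nonempty: "dyadic_cell a \<noteq> {}"
proof (cases a)
  case (Pair j k)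
  then have "Complex (side j / 2) (of_int k * side j) \<in> dyadic_cell a"
    by (simp add: dyadic_cell_def)
  then show ?thesis by blast
qed

lemma dyadic_cell_subset_imp_le:
  assumes "dyadic_cell a \<subseteq> dyadic_cell b"
  shows "fst a \<le> fst b"
proof (rule ccontr)
  obtain i l j k where ab: "a = (i, l)" "b = (j, k)" by (cases a, cases b)
  assume "\<not> fst a \<le> fst b"
  then have "2 * side j \<le> side i" using side_less_half[of j i] ab by simp
  then have "side j < side i" using side_pos[of j] by linarith
  then have "Complex (side j) (of_int l * side i) \<in> dyadic_cell a"
    using side_pos[of i] by (simp add: ab dyadic_cell_def)
  with assms have "Complex (side j) (of_int l * side i) \<in> dyadic_cell b" by blast
  then show False by (simp add: ab dyadic_cell_def)
qed

lemma dyadic_cell_subset: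
  assumes "dyadic_cell a \<inter> dyadic_cell b \<noteq> {}" "fst a \<le> fst b"
  shows "dyadic_cell a \<subseteq> dyadic_cell b"
proof -
  obtain i l j k where ab: "a = (i, l)" "b = (j, k)" by (cases a, cases b)
  then obtain z where z: "z \<in> dyadic_cell (i, l)" "z \<in> dyadic_cell (j, k)" using assms by blast
  have ij: "i \<le> j" using assms ab by simp
  show ?thesis
    using dyadic_cell_nested[OF ij z] side_mono[OF ij] unfolding ab by (auto simp: dyadic_cell_def)
qed

lemma dyadic_cell_same_level:
  assumes "dyadic_cell a \<inter> dyadic_cell b \<noteq> {}" "fst a = fst b"
  shows "a = b"
proof -
  obtain j l k where ab: "a = (j, l)" "b = (j, k)" using assms by (cases a, cases b) auto
  then obtain z where z: "z \<in> dyadic_cell (j, l)" "z \<in> dyadic_cell (j, k)" using assms by blast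
  have "real_of_int k \<le> of_int l" "real_of_int l \<le> of_int k"
    using dyadic_cell_nested[OF order_refl z] dyadic_cell_nested[OF order_refl z(2,1)] side_pos[of j] by simp_all
  then show ?thesis by (simp add: ab)
qed

lemma laminar_dyadic: "finite S \<Longrightarrow> laminar_family S dyadic_cell fst"
  by unfold_locales
    (use dyadic_cell_nonempty dyadic_cell_subset_imp_le dyadic_cell_subset dyadic_cell_same_level in blast)+

lemma cell_centre_in: "cell_centre a \<in> right_half_plane"
  by (cases a) (simp add: cell_centre_def right_half_plane_def)

lemma carleson_cell_centre:
  "carleson_square (cell_centre (j, k)) \<inter> right_half_plane =
     {z. 0 < Re z \<and> Re z < side j \<and> of_int k * side j \<le> Im z \<and> Im z \<le> (of_int k + 1) * side j}"
proof -
  have "\<bar>y - (of_int k + 1 / 2) * side j\<bar> \<le> side j / 2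
      \<longleftrightarrow> of_int k * side j \<le> y \<and> y \<le> (of_int k + 1) * side j" for y
    unfolding distrib_right by linarith
  then show ?thesis
    unfolding carleson_square_def right_half_plane_def cell_centre_def by auto
qed

lemma dyadic_cell_subset_carleson:
  "dyadic_cell a \<subseteq> carleson_square (cell_centre a) \<inter> right_half_plane"
  by (cases a) (auto simp: carleson_cell_centre dyadic_cell_def)

lemma carleson_cell_mono:
  assumes "dyadic_cell a \<subseteq> dyadic_cell b"
  shows "carleson_square (cell_centre a) \<inter> right_half_plane
    \<subseteq> carleson_square (cell_centre b) \<inter> right_half_plane"
proof -
  obtain i l j k where ab: "a = (i, l)" "b = (j, k)" by (cases a, cases b)
  obtain z where z: "z \<in> dyadic_cell (i, l)" "z \<in> dyadic_cell (j, k)"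
    using dyadic_cell_nonempty[of a] assms ab by blast
  have ij: "i \<le> j" using dyadic_cell_subset_imp_le[OF assms] ab by simp
  show ?thesis
    using dyadic_cell_nested[OF ij z] side_mono[OF ij] unfolding ab carleson_cell_centre by auto
qed

lemma top_core_iff: "z \<in> top_core (j, k) \<longleftrightarrow> 3 / 4 * side j < Re z \<and> Re z < 7 / 8 * side j \<and>
    (of_int k + 1 / 4) * side j < Im z \<and> Im z < (of_int k + 3 / 4) * side j"
  by (auto simp: top_core_def box_def Basis_complex_def)

lemma top_enlarged_iff: "z \<in> top_enlarged (j, k) \<longleftrightarrow> side j / 4 < Re z \<and> Re z < 5 / 4 * side j \<and>
    (of_int k - 1 / 4) * side j < Im z \<and> Im z < (of_int k + 5 / 4) * side j"
  by (auto simp: top_enlarged_def box_def Basis_complex_def)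

lemma top_half_iff: "z \<in> top_half (j, k) \<longleftrightarrow> side j / 2 \<le> Re z \<and> Re z \<le> side j \<and>
    of_int k * side j \<le> Im z \<and> Im z \<le> (of_int k + 1) * side j"
  by (auto simp: top_half_def cbox_def Basis_complex_def)

lemma top_core_subset: "top_core a \<subseteq> dyadic_cell a" "top_core a \<subseteq> top_enlarged a"
proof -
  obtain j k where a: "a = (j, k)" by (cases a)
  show "top_core a \<subseteq> dyadic_cell a" "top_core a \<subseteq> top_enlarged a"
    using side_pos[of j] unfolding a
    by (auto simp: top_core_iff top_enlarged_iff dyadic_cell_def algebra_simps)
qed

lemma top_enlarged_subset: "top_enlarged a \<subseteq> right_half_plane"
proof (cases a)
  case (Pair j k)
  then show ?thesis using side_pos[of j] by (auto simp: top_enlarged_iff right_half_plane_def)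
qed

lemma carleson_subset_core:
  assumes "z \<in> top_core a"
  shows "carleson_square (cell_centre a) \<inter> right_half_plane \<subseteq> carleson_square z"
proof -
  obtain j k where a: "a = (j, k)" by (cases a)
  show ?thesis using assms unfolding a carleson_cell_centre
    by (auto simp: top_core_iff carleson_square_def abs_le_iff algebra_simps)
qed

lemma top_core_disjoint:
  assumes "z \<in> top_core a" "z \<in> top_core b"
  shows "a = b"
proof -
  obtain i l j k where ab: "a = (i, l)" "b = (j, k)" by (cases a, cases b)
  have "\<not> i < j" "\<not> j < i"
    using assms side_less_half[of i j] side_less_half[of j i] side_pos[of i] side_pos[of j]
    by (auto simp: ab top_core_iff)
  then have "fst a = fst b" by (simp add: ab)
  moreover have "dyadic_cell a \<inter> dyadic_cell b \<noteq> {}" using top_core_subset(1) assms by blast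
  ultimately show ?thesis by (rule dyadic_cell_same_level[rotated])
qed

lemma emeasure_top_core: "emeasure lborel (top_core a) = ennreal ((side (fst a))\<^sup>2 / 16)"
proof -
  obtain j k where a: "a = (j, k)" by (cases a)
  show ?thesis
    unfolding a top_core_def prod.case
    by (subst emeasure_lborel_box)
      (auto simp: Basis_complex_def power2_eq_square ennreal_mult'[symmetric] algebra_simps mult_le_cancel_right)
qed

lemma regular_weight_comparable:
  assumes "regular_weight \<rho>"
  obtains \<delta> where "0 < \<delta>"
    "\<And>a z w. z \<in> top_enlarged a \<Longrightarrow> w \<in> top_enlarged a \<Longrightarrow> \<rho> z \<le> \<delta> * \<rho> w"
proof -
  \<comment> \<open>In an enlarged top half of side s, real parts exceed s/4 and differ by at most
    s, and imaginary parts differ by at most 3 s/2. The quotient in \<open>hyperbolic_dist\<close>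
    is thus at most (13/4)/(1/8) = 26, and 27 = 1 + 26.\<close>
  have "0 < arcosh (27::real)" by simp
  with assms have "\<exists>\<delta>>0. \<forall>z\<in>right_half_plane. \<forall>w\<in>right_half_plane.
      hyperbolic_dist z w \<le> arcosh 27 \<longrightarrow> \<rho> z \<le> \<delta> * \<rho> w"
    unfolding regular_weight_def by simp
  then obtain \<delta> where d: "0 < \<delta>" "\<And>z w. z \<in> right_half_plane \<Longrightarrow> w \<in> right_half_plane \<Longrightarrow>
      hyperbolic_dist z w \<le> arcosh 27 \<Longrightarrow> \<rho> z \<le> \<delta> * \<rho> w"
    by auto
  show ?thesis
  proof (rule that[OF d(1)])
    fix a z w assume zw: "z \<in> top_enlarged a" "w \<in> top_enlarged a"
    obtain j k where a: "a = (j, k)" by (cases a)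
    define s where "s = side j"
    have s: "0 < s" by (simp add: s_def)
    have b: "s / 4 < Re z" "s / 4 < Re w" "\<bar>Re z - Re w\<bar> \<le> s" "\<bar>Im z - Im w\<bar> \<le> 3 / 2 * s"
      using zw unfolding a top_enlarged_iff s_def left_diff_distrib distrib_right by linarith+
    have "(Re z - Re w)\<^sup>2 \<le> s\<^sup>2" "(Im z - Im w)\<^sup>2 \<le> (3 / 2 * s)\<^sup>2"
      using b s by (auto simp: abs_le_square_iff[symmetric])
    then have "(cmod (z - w))\<^sup>2 \<le> 13 / 4 * s\<^sup>2" unfolding cmod_power2 power_mult_distrib by (simp add: power2_eq_square)
    moreover have "s / 4 * (s / 4) \<le> Re z * Re w" using b s by (intro mult_mono) auto
    then have "s\<^sup>2 / 8 \<le> 2 * Re z * Re w" by (simp add: power2_eq_square)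
    moreover have "0 < 2 * Re z * Re w" using b s by simp
    ultimately have "(cmod (z - w))\<^sup>2 / (2 * Re z * Re w) \<le> 26"
      by (subst pos_divide_le_eq) linarith+
    moreover have "0 \<le> (cmod (z - w))\<^sup>2 / (2 * Re z * Re w)" using b s by auto
    ultimately have "hyperbolic_dist z w \<le> arcosh 27"
      unfolding hyperbolic_dist_def not_less[symmetric] by (subst arcosh_less_iff_real) auto
    then show "\<rho> z \<le> \<delta> * \<rho> w"
      using d(2) zw top_enlarged_subset by blast
  qed
qed

text \<open>The real part of z leaves three generations, and in each of them the imaginary part
  leaves three neighbours.\<close>

lemma top_enlarged_overlap: "card {a\<in>S. z \<in> top_enlarged a} \<le> 9"
proof (cases "Re z > 0")
  case True
  obtain i where i: "side i / 2 \<le> Re z" "Re z < side i" using side_floor[OF True] by blast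
  let ?K = "\<lambda>j. {\<lfloor>Im z / side j\<rfloor> - 1..\<lfloor>Im z / side j\<rfloor> + 1}"
  have "{a\<in>S. z \<in> top_enlarged a} \<subseteq> Sigma {i - 1..i + 1} ?K"
  proof
    fix a assume a: "a \<in> {a\<in>S. z \<in> top_enlarged a}"
    obtain j k where jk: "a = (j, k)" by (cases a)
    have z: "side j / 4 < Re z" "Re z < 5 / 4 * side j"
      "(of_int k - 1 / 4) * side j < Im z" "Im z < (of_int k + 5 / 4) * side j"
      using a jk by (auto simp: top_enlarged_iff)
    have "\<not> i + 1 < j" using z i side_less_half[of "i + 1" j] by (auto simp: side_double)
    moreover have "\<not> j < i - 1" using z i side_less_half[of j "i - 1"] side_double[of "i - 1"] by auto
    ultimately have j: "j \<in> {i - 1..i + 1}" by auto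
    have "of_int k - 1 / 4 < Im z / side j" "Im z / side j < of_int k + 5 / 4"
      using z(3,4) by (simp_all add: pos_less_divide_eq pos_divide_less_eq)
    then have "k \<in> ?K j" by simp linarith
    with j show "a \<in> Sigma {i - 1..i + 1} ?K" unfolding jk by blast
  qed
  then have "card {a\<in>S. z \<in> top_enlarged a} \<le> card (Sigma {i - 1..i + 1} ?K)"
    by (intro card_mono finite_SigmaI) auto
  also have "\<dots> = 9" by (subst card_SigmaI) auto
  finally show ?thesis .
next
  case False
  then have "{a\<in>S. z \<in> top_enlarged a} = {}"
    using top_enlarged_subset by (auto simp: right_half_plane_def)
  then show ?thesis by (simp only: card.empty)
qed

section \<open>Oscillation along horizontal rays\<close>

lemma side_nonneg [simp]: "0 \<le> side j"
  by (rule less_imp_le) simp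

lemma open_right_half_plane [simp]: "open right_half_plane"
  unfolding right_half_plane_def by (intro open_Collect_less continuous_intros)

lemma convex_top_half: "convex (top_half a)" and compact_top_half: "compact (top_half a)"
  by (cases a; simp add: top_half_def)+

lemma top_half_subset: "top_half a \<subseteq> right_half_plane"
proof (cases a)
  case (Pair j k)
  show ?thesis
  proof
    fix z assume "z \<in> top_half a"
    then have "side j \<le> Re z * 2" by (simp add: Pair top_half_iff)
    then show "z \<in> right_half_plane" using side_pos[of j] unfolding right_half_plane_def mem_Collect_eq by linarith
  qed
qed

lemma top_half_nonempty: "top_half a \<noteq> {}"
proof (cases a)
  case (Pair j k)
  then have "Complex (side j) (of_int k * side j) \<in> top_half a"
    using side_pos[of j] by (simp add: top_half_iff algebra_simps)
  then show ?thesis by blast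
qed

lemma exists_max_on_top_half:
  assumes "F holomorphic_on right_half_plane"
  shows "\<exists>\<zeta>. \<forall>a. \<zeta> a \<in> top_half a \<and> (\<forall>z\<in>top_half a. cmod (deriv F z) \<le> cmod (deriv F (\<zeta> a)))"
proof (rule choice, rule allI)
  fix a
  have "continuous_on (top_half a) (\<lambda>z. cmod (deriv F z))"
    by (intro continuous_on_norm continuous_on_subset[OF _ top_half_subset]
        holomorphic_on_imp_continuous_on holomorphic_deriv assms open_right_half_plane)
  from continuous_attains_sup[OF compact_top_half top_half_nonempty this]
  show "\<exists>\<zeta>. \<zeta> \<in> top_half a \<and> (\<forall>z\<in>top_half a. cmod (deriv F z) \<le> cmod (deriv F \<zeta>))" by blast
qed

text \<open>An increasing exhaustion of the tree by finite sets: absorption in the Hardy inequality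
  needs finite sums, and monotone convergence needs an increasing sequence.\<close>

definition index_box :: "nat \<Rightarrow> (int \<times> int) set" where
  "index_box n = {- int n..int n} \<times> {- int n..int n}"

lemma finite_index_box [simp]: "finite (index_box n)"
  by (simp add: index_box_def)

lemma index_box_mono: "m \<le> n \<Longrightarrow> index_box m \<subseteq> index_box n"
  by (auto simp: index_box_def)

lemma finite_subset_index_box:
  assumes "finite A"
  shows "\<exists>n. A \<subseteq> index_box n"
  using assms
proof induction
  case (insert a A)
  then obtain n where n: "A \<subseteq> index_box n" by blast
  obtain j k where a: "a = (j, k)" by (cases a)
  let ?n = "n + nat \<bar>j\<bar> + nat \<bar>k\<bar>"
  have "A \<subseteq> index_box ?n" using n index_box_mono[of n ?n] by auto
  moreover have "a \<in> index_box ?n" by (auto simp: a index_box_def)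
  ultimately show ?case by blast
qed simp

lemma oscillation_on_top_half:
  assumes F: "F holomorphic_on right_half_plane"
    and max: "\<And>z. z \<in> top_half (j, k) \<Longrightarrow> cmod (deriv F z) \<le> B"
    and z: "z \<in> top_half (j, k)" "w \<in> top_half (j, k)" "Im z = Im w"
  shows "cmod (F z - F w) \<le> side j * B"
proof -
  have "cmod (F z - F w) \<le> B * cmod (z - w)"
  proof (rule field_differentiable_bound[OF convex_top_half _ max z(1,2)])
    fix u assume "u \<in> top_half (j, k)"
    then have "u \<in> right_half_plane" using top_half_subset by blast
    then show "(F has_field_derivative deriv F u) (at u within top_half (j, k))"
      using holomorphic_derivI[OF F open_right_half_plane] by blast
  qed
  also have "\<dots> \<le> B * side j"
  proof (rule mult_left_mono)
    have "cmod (z - w) = \<bar>Re z - Re w\<bar>" using z(3) by (simp add: cmod_def)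
    also have "\<dots> \<le> side j" using z side_pos[of j] unfolding top_half_iff by linarith
    finally show "cmod (z - w) \<le> side j" .
    show "0 \<le> B" using max[OF z(1)] norm_ge_zero[of "deriv F z"] by linarith
  qed
  finally show ?thesis by (simp add: mult.commute)
qed

text \<open>Telescoping along the horizontal ray from \<open>w\<close>: its points lie in the top halves of the dyadic
  cells containing \<open>w\<close>.\<close>

lemma norm_le_sum_oscillations:
  fixes g :: "int \<times> int \<Rightarrow> real"
  assumes F: "F holomorphic_on right_half_plane"
    and lim: "((\<lambda>x. F (Complex x (Im w))) \<longlongrightarrow> 0) at_top"
    and max: "\<And>a z. z \<in> top_half a \<Longrightarrow> cmod (deriv F z) \<le> B a"
    and w: "w \<in> right_half_plane"
    and g: "\<And>a. g a = side (fst a) * B a"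
  shows "\<exists>n. cmod (F w) \<le> 2 * (\<Sum>a | a \<in> index_box n \<and> w \<in> dyadic_cell a. g a)"
proof -
  have B0: "0 \<le> B a" for a
    using max top_half_nonempty[of a] norm_ge_zero order_trans by blast
  then have g0: "0 \<le> g a" for a by (simp add: g)
  define y where "y = Im w"
  define \<kappa> where "\<kappa> j = \<lfloor>y / side j\<rfloor>" for j
  have \<kappa>: "of_int (\<kappa> j) * side j \<le> y" "y < (of_int (\<kappa> j) + 1) * side j" for j
  proof -
    have "of_int (\<kappa> j) \<le> y / side j" "y / side j < of_int (\<kappa> j) + 1"
      unfolding \<kappa>_def by linarith+
    then show "of_int (\<kappa> j) * side j \<le> y" "y < (of_int (\<kappa> j) + 1) * side j"
      by (simp_all add: pos_le_divide_eq pos_divide_less_eq)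
  qed
  obtain i where i: "side i / 2 \<le> Re w" "Re w < side i"
    using w side_floor[of "Re w"] by (auto simp: right_half_plane_def)
  have wy: "w = Complex (Re w) y" by (simp add: y_def)
  have th: "Complex x y \<in> top_half (j, \<kappa> j)" if "side j / 2 \<le> x" "x \<le> side j" for x j
    using that \<kappa>[of j] by (simp add: top_half_iff)
  have chain: "cmod (F w) \<le> cmod (F (Complex (side J) y)) + (\<Sum>j\<in>{i..J}. g (j, \<kappa> j))" if "i \<le> J" for J
    using that
  proof (induction J rule: int_ge_induct)
    case base
    have "cmod (F w - F (Complex (side i) y)) \<le> g (i, \<kappa> i)"
      unfolding g fst_conv
    proof (rule oscillation_on_top_half[OF F max])
      show "w \<in> top_half (i, \<kappa> i)" by (subst wy, rule th) (use i in auto)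
      show "Complex (side i) y \<in> top_half (i, \<kappa> i)" using side_pos[of i] by (intro th) auto
    qed (auto simp: y_def)
    then show ?case using norm_triangle_sub[of "F w" "F (Complex (side i) y)"] by simp
  next
    case (step J)
    have "cmod (F (Complex (side J) y) - F (Complex (side (J + 1)) y)) \<le> g (J + 1, \<kappa> (J + 1))"
      unfolding g fst_conv
    proof (rule oscillation_on_top_half[OF F max])
      show "Complex (side J) y \<in> top_half (J + 1, \<kappa> (J + 1))"
        "Complex (side (J + 1)) y \<in> top_half (J + 1, \<kappa> (J + 1))"
        by (rule th; simp add: side_double)+
    qed auto
    moreover have "{i..J + 1} = insert (J + 1) {i..J}" using step.hyps by auto
    ultimately show ?case
      using step.IH norm_triangle_sub[of "F (Complex (side J) y)" "F (Complex (side (J + 1)) y)"] by simp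
  qed
  show ?thesis
  proof (cases "F w = 0")
    case True
    then show ?thesis using g0 by (auto intro!: sum_nonneg exI[of _ 0])
  next
    case False
    \<comment> \<open>The ray is followed only until |F| falls below |F w|/2. Absorbing this
      remainder keeps the sum finite and accounts for the factor 2 in the statement.\<close>
    then have "0 < cmod (F w) / 2" by simp
    from tendstoD[OF lim this] have "\<forall>\<^sub>F x in at_top. cmod (F (Complex x y)) < cmod (F w) / 2"
      unfolding y_def dist_norm by simp
    then obtain x0 where x0: "\<And>x. x0 \<le> x \<Longrightarrow> cmod (F (Complex x y)) < cmod (F w) / 2"
      unfolding eventually_at_top_linorder by blast
    obtain J where J: "i \<le> J" "x0 < side J" using side_unbounded by blast
    let ?A = "(\<lambda>j. (j, \<kappa> j)) ` {i..J}"
    obtain n where n: "?A \<subseteq> index_box n" using finite_subset_index_box[of ?A] by auto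
    have "w \<in> dyadic_cell a" if aA: "a \<in> ?A" for a
    proof -
      obtain j where j: "a = (j, \<kappa> j)" "i \<le> j" using aA by auto
      show ?thesis
        using i(2) side_mono[OF j(2)] \<kappa>[of j] w by (auto simp: j dyadic_cell_def right_half_plane_def y_def)
    qed
    with n have "?A \<subseteq> {a. a \<in> index_box n \<and> w \<in> dyadic_cell a}" by auto
    then have "sum g ?A \<le> (\<Sum>a | a \<in> index_box n \<and> w \<in> dyadic_cell a. g a)"
      using g0 by (intro sum_mono2) auto
    moreover have "sum g ?A = (\<Sum>j\<in>{i..J}. g (j, \<kappa> j))"
      by (subst sum.reindex) (auto simp: inj_on_def)
    moreover have "cmod (F w) / 2 \<le> (\<Sum>j\<in>{i..J}. g (j, \<kappa> j))"
      using chain[OF J(1)] x0[of "side J"] J(2) by simp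
    ultimately show ?thesis by (intro exI[of _ n]) simp
  qed
qed

section \<open>From oscillations to the weighted area integral\<close>

text \<open>One bound for both signs of the exponent, as p - 2 may be negative.\<close>

lemma powr_le_powr_abs:
  fixes t s :: real
  assumes "1 / 4 \<le> t" "t \<le> 4"
  shows "t powr s \<le> 4 powr \<bar>s\<bar>"
proof (cases "0 \<le> s")
  case True
  then show ?thesis using assms by (simp add: powr_mono2)
next
  case False
  then have "t powr s \<le> (1 / 4) powr s" using assms by (intro powr_mono2') auto
  also have "\<dots> = 4 powr \<bar>s\<bar>" using False by (simp add: powr_divide powr_minus_divide[of 4 s])
  finally show ?thesis .
qed

text \<open>Origin of \<open>K\<close>: 16 from squares of half-side s/4,
  \<open>8 * 32 powr (p - 1)\<close> from the mean value inequality, 9 from the overlap of enlarged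
  top halves, \<open>4 powr \<bar>p - 2\<bar>\<close> from replacing the side by Re z, and
  \<open>\<delta>\<close> from moving the weight from the centre to z.\<close>

lemma sum_oscillations_le:
  assumes p: "1 \<le> p" and F: "F holomorphic_on right_half_plane"
    and \<rho>: "\<And>z. z \<in> right_half_plane \<Longrightarrow> 0 < \<rho> z"
    and \<delta>: "0 < \<delta>" "\<And>a z w. z \<in> top_enlarged a \<Longrightarrow> w \<in> top_enlarged a \<Longrightarrow> \<rho> z \<le> \<delta> * \<rho> w"
    and \<zeta>: "\<And>a. \<zeta> a \<in> top_half a"
    and S: "finite S"
  defines "K \<equiv> 16 * (8 * 32 powr (p - 1)) * (9 * 4 powr \<bar>p - 2\<bar> * \<delta>)"
  shows "ennreal (\<Sum>a\<in>S. (side (fst a) * cmod (deriv F (\<zeta> a))) powr p * \<rho> (cell_centre a))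
    \<le> ennreal K * (\<integral>\<^sup>+z\<in>right_half_plane. ennreal (cmod (deriv F z) powr p * Re z powr (p - 2) * \<rho> z) \<partial>lebesgue)"
proof -
  define K1 where "K1 = 16 * (8 * 32 powr (p - 1))"
  have K1: "0 < K1" by (simp add: K1_def)
  have F': "deriv F holomorphic_on right_half_plane"
    using F by (rule holomorphic_deriv) simp
  define \<phi> where "\<phi> z = ennreal (cmod (deriv F z) powr p)" for z
  define c where "c a = side (fst a) powr (p - 2) * \<rho> (cell_centre a)" for a
  have centre: "cell_centre a \<in> top_enlarged a" for a
    by (cases a) (simp add: cell_centre_def top_enlarged_iff algebra_simps)
  have \<rho>0: "0 < \<rho> (cell_centre a)" for a by (rule \<rho>[OF cell_centre_in])
  then have c0: "0 \<le> c a" for a by (simp add: c_def less_imp_le)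
  have op: "open (top_enlarged a)" for a by (cases a) (simp add: top_enlarged_def open_box)
  have m: "(\<lambda>z. \<phi> z * indicator (top_enlarged a) z) \<in> borel_measurable lborel" for a
    using borel_measurable_norm_on_open[OF continuous_on_subset[OF
        holomorphic_on_imp_continuous_on[OF F'] top_enlarged_subset] op]
    by (simp add: \<phi>_def)
  have term_le: "ennreal ((side (fst a) * cmod (deriv F (\<zeta> a))) powr p * \<rho> (cell_centre a))
      \<le> ennreal K1 * (\<integral>\<^sup>+z. ennreal (c a) * (\<phi> z * indicator (top_enlarged a) z) \<partial>lborel)" for a
  proof -
    obtain j k where a: "a = (j, k)" by (cases a)
    define s where "s = side j"
    have s: "0 < s" by (simp add: s_def)
    have sub: "open_square (\<zeta> a) (s / 4) \<subseteq> top_enlarged a"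
    proof
      fix u assume u: "u \<in> open_square (\<zeta> a) (s / 4)"
      then show "u \<in> top_enlarged a"
        using \<zeta>[of a] s unfolding a top_half_iff top_enlarged_iff open_square_def mem_Collect_eq
          s_def[symmetric] left_diff_distrib distrib_right
        by linarith
    qed
    have "ennreal ((s / 4)\<^sup>2 * cmod (deriv F (\<zeta> a)) powr p)
        \<le> ennreal (8 * 32 powr (p - 1)) * (\<integral>\<^sup>+z\<in>open_square (\<zeta> a) (s / 4). \<phi> z \<partial>lborel)"
      unfolding \<phi>_def using s p
      by (intro area_mean_value_powr holomorphic_on_subset[OF F' order_trans[OF sub top_enlarged_subset]]) auto
    also have "\<dots> \<le> ennreal (8 * 32 powr (p - 1)) * (\<integral>\<^sup>+z. \<phi> z * indicator (top_enlarged a) z \<partial>lborel)"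
      using sub by (intro mult_left_mono nn_integral_mono) (auto split: split_indicator)
    finally have mv: "ennreal ((s / 4)\<^sup>2 * cmod (deriv F (\<zeta> a)) powr p)
        \<le> ennreal (8 * 32 powr (p - 1)) * (\<integral>\<^sup>+z. \<phi> z * indicator (top_enlarged a) z \<partial>lborel)" .
    have "(s * cmod (deriv F (\<zeta> a))) powr p * \<rho> (cell_centre a)
        = (16 * c a) * ((s / 4)\<^sup>2 * cmod (deriv F (\<zeta> a)) powr p)"
      using s by (simp add: c_def a s_def[symmetric] powr_mult powr_diff field_simps)
    then have "ennreal ((s * cmod (deriv F (\<zeta> a))) powr p * \<rho> (cell_centre a))
        = ennreal (16 * c a) * ennreal ((s / 4)\<^sup>2 * cmod (deriv F (\<zeta> a)) powr p)"
      using c0[of a] by (simp only: ennreal_mult')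
    also have "\<dots> \<le> ennreal (16 * c a) *
        (ennreal (8 * 32 powr (p - 1)) * (\<integral>\<^sup>+z. \<phi> z * indicator (top_enlarged a) z \<partial>lborel))"
      using mv by (rule mult_left_mono) simp
    also have "\<dots> = ennreal K1 * (ennreal (c a) * (\<integral>\<^sup>+z. \<phi> z * indicator (top_enlarged a) z \<partial>lborel))"
      using c0[of a] by (simp add: K1_def ennreal_mult' mult_ac)
    also have "ennreal (c a) * (\<integral>\<^sup>+z. \<phi> z * indicator (top_enlarged a) z \<partial>lborel)
        = (\<integral>\<^sup>+z. ennreal (c a) * (\<phi> z * indicator (top_enlarged a) z) \<partial>lborel)"
      by (rule nn_integral_cmult[OF m, symmetric])
    finally show ?thesis by (simp add: a s_def)
  qed
  have pw: "(\<Sum>a\<in>S. ennreal (c a) * (\<phi> z * indicator (top_enlarged a) z))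
      \<le> ennreal (9 * 4 powr \<bar>p - 2\<bar> * \<delta>) *
        (ennreal (cmod (deriv F z) powr p * Re z powr (p - 2) * \<rho> z) * indicator right_half_plane z)" for z
  proof (cases "z \<in> right_half_plane")
    case False
    then have "z \<notin> top_enlarged a" for a using top_enlarged_subset by blast
    then show ?thesis by simp
  next
    case True
    then have z: "0 < Re z" by (simp add: right_half_plane_def)
    define L where "L = 4 powr \<bar>p - 2\<bar> * \<delta> * (Re z powr (p - 2) * \<rho> z)"
    have L0: "0 \<le> L" using \<delta>(1) \<rho>[OF True] by (simp add: L_def)
    have cL: "c a \<le> L" if za: "z \<in> top_enlarged a" for a
    proof -
      obtain j k where a: "a = (j, k)" by (cases a)
      have "side j / 4 < Re z" "Re z < 5 / 4 * side j" using za by (auto simp: a top_enlarged_iff)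
      then have "1 / 4 \<le> side j / Re z" "side j / Re z \<le> 4"
        using z side_pos[of j] by (simp_all add: field_simps)
      then have "(side j / Re z) powr (p - 2) \<le> 4 powr \<bar>p - 2\<bar>" by (rule powr_le_powr_abs)
      then have "side j powr (p - 2) \<le> 4 powr \<bar>p - 2\<bar> * Re z powr (p - 2)"
        using z by (simp add: powr_divide divide_le_eq)
      then have "c a \<le> (4 powr \<bar>p - 2\<bar> * Re z powr (p - 2)) * (\<delta> * \<rho> z)"
        unfolding c_def a fst_conv using \<delta>(2)[OF centre za] \<rho>0[of a] a
        by (intro mult_mono) (auto intro: less_imp_le)
      then show ?thesis by (simp add: L_def mult_ac)
    qed
    have "(\<Sum>a\<in>S. ennreal (c a) * (\<phi> z * indicator (top_enlarged a) z))
        = (\<Sum>a | a \<in> S \<and> z \<in> top_enlarged a. ennreal (c a) * \<phi> z)"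
      using S by (intro sum.mono_neutral_cong_right) auto
    also have "\<dots> \<le> (\<Sum>a | a \<in> S \<and> z \<in> top_enlarged a. ennreal L * \<phi> z)"
      using cL by (intro sum_mono mult_right_mono ennreal_leI) auto
    also have "\<dots> = of_nat (card {a\<in>S. z \<in> top_enlarged a}) * (ennreal L * \<phi> z)" by simp
    also have "\<dots> \<le> of_nat 9 * (ennreal L * \<phi> z)"
      by (intro mult_right_mono of_nat_mono top_enlarged_overlap) simp
    also have "\<dots> = ennreal (9 * (L * cmod (deriv F z) powr p))"
      using L0 by (simp add: \<phi>_def ennreal_mult')
    also have "9 * (L * cmod (deriv F z) powr p)
        = 9 * 4 powr \<bar>p - 2\<bar> * \<delta> * (cmod (deriv F z) powr p * Re z powr (p - 2) * \<rho> z)"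
      by (simp add: L_def mult_ac)
    finally show ?thesis using True \<delta>(1) by (simp add: ennreal_mult')
  qed
  define K2 where "K2 = 9 * 4 powr \<bar>p - 2\<bar> * \<delta>"
  have K2: "0 < K2" using \<delta>(1) by (simp add: K2_def)
  define G where "G z = (\<Sum>a\<in>S. ennreal (c a) * (\<phi> z * indicator (top_enlarged a) z))" for z
  have G: "G \<in> borel_measurable lborel"
    unfolding G_def[abs_def]
    by (intro borel_measurable_sum) (rule borel_measurable_times_ennreal[OF borel_measurable_const m])
  define h where "h z = ennreal (cmod (deriv F z) powr p * Re z powr (p - 2) * \<rho> z)" for z
  have "ennreal (\<Sum>a\<in>S. (side (fst a) * cmod (deriv F (\<zeta> a))) powr p * \<rho> (cell_centre a))
      = (\<Sum>a\<in>S. ennreal ((side (fst a) * cmod (deriv F (\<zeta> a))) powr p * \<rho> (cell_centre a)))"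
    by (intro sum_ennreal[symmetric] mult_nonneg_nonneg powr_ge_zero less_imp_le[OF \<rho>0])
  also have "\<dots> \<le> (\<Sum>a\<in>S. ennreal K1 * (\<integral>\<^sup>+z. ennreal (c a) * (\<phi> z * indicator (top_enlarged a) z) \<partial>lborel))"
    by (intro sum_mono term_le)
  also have "\<dots> = ennreal K1 * (\<Sum>a\<in>S. \<integral>\<^sup>+z. ennreal (c a) * (\<phi> z * indicator (top_enlarged a) z) \<partial>lborel)"
    by (simp add: sum_distrib_left)
  also have "(\<Sum>a\<in>S. \<integral>\<^sup>+z. ennreal (c a) * (\<phi> z * indicator (top_enlarged a) z) \<partial>lborel)
      = (\<integral>\<^sup>+z. (\<Sum>a\<in>S. ennreal (c a) * (\<phi> z * indicator (top_enlarged a) z)) \<partial>lborel)"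
    by (intro nn_integral_sum[symmetric]) (rule borel_measurable_times_ennreal[OF borel_measurable_const m])
  \<comment> \<open>A regular weight is Lebesgue measurable, so the comparison with \<open>h\<close>
    takes place under the completed measure.\<close>
  also have "\<dots> = (\<integral>\<^sup>+z. G z \<partial>lebesgue)"
    unfolding G_def[symmetric] by (simp add: nn_integral_completion)
  \<comment> \<open>The constant is put on \<open>G\<close>, whose measurability is at hand;
    afterwards monotonicity alone leads to \<open>h\<close>.\<close>
  also have "\<dots> = ennreal K2 * (\<integral>\<^sup>+z. ennreal (1 / K2) * G z \<partial>lebesgue)"
    using K2 measurable_completion[OF G]
    by (simp add: nn_integral_cmult mult.assoc[symmetric] ennreal_mult'[symmetric])
  also have "ennreal K1 * (ennreal K2 * (\<integral>\<^sup>+z. ennreal (1 / K2) * G z \<partial>lebesgue))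
      \<le> ennreal K1 * (ennreal K2 * (\<integral>\<^sup>+z. h z * indicator right_half_plane z \<partial>lebesgue))"
  proof (intro mult_left_mono nn_integral_mono)
    fix z
    have "ennreal (1 / K2) * G z \<le> ennreal (1 / K2) * (ennreal K2 * (h z * indicator right_half_plane z))"
      using pw[of z] by (intro mult_left_mono) (auto simp: G_def h_def K2_def)
    then show "ennreal (1 / K2) * G z \<le> h z * indicator right_half_plane z"
      using K2 by (simp add: mult.assoc[symmetric] ennreal_mult'[symmetric])
  qed auto
  finally have "ennreal (\<Sum>a\<in>S. (side (fst a) * cmod (deriv F (\<zeta> a))) powr p * \<rho> (cell_centre a))
      \<le> ennreal (K1 * K2) * (\<integral>\<^sup>+z. h z * indicator right_half_plane z \<partial>lebesgue)"
    using K1 by (simp only: ennreal_mult' less_imp_le mult.assoc)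
  moreover have "K = K1 * K2" by (simp only: K_def K1_def K2_def)
  ultimately show ?thesis by (simp only: h_def)
qed

section \<open>Integrals of powers of branch sums\<close>

text \<open>Telescoping linearises the power: it becomes a combination of indicators with
  nonnegative coefficients independent of \<open>x\<close>, which also settles its
  measurability.\<close>

lemma (in laminar_family) chain_sum_powr_eq:
  assumes g: "\<And>a. a \<in> S \<Longrightarrow> 0 \<le> g a" and q: "0 < q"
  shows "ennreal ((\<Sum>a | a \<in> S \<and> x \<in> P a. g a) powr q)
    = (\<Sum>a\<in>S. ennreal (up_sum g a powr q - (up_sum g a - g a) powr q) * indicator (P a) x)"
proof -
  define D where "D a = up_sum g a powr q - (up_sum g a - g a) powr q" for a
  have D: "0 \<le> D a" if "a \<in> S" for a
    using up_sum_ge[of a g, OF that g] q by (simp add: D_def powr_mono2)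
  have "(\<Sum>a | a \<in> S \<and> x \<in> P a. g a) powr q = (\<Sum>a | a \<in> S \<and> x \<in> P a. D a)"
    using up_set_of_point[where x = x and \<phi> = "\<lambda>t. t powr q" and g = g] by (simp add: D_def)
  also have "ennreal \<dots> = (\<Sum>a | a \<in> S \<and> x \<in> P a. ennreal (D a))"
    using D by (intro sum_ennreal[symmetric]) auto
  also have "\<dots> = (\<Sum>a\<in>S. ennreal (D a) * indicator (P a) x)"
    using finite_S by (intro sum.mono_neutral_cong_left) auto
  finally show ?thesis by (simp add: D_def)
qed

text \<open>The numbers \<open>m a\<close> only dominate the measures because the testing condition
  controls Carleson squares, which are slightly larger than cells.\<close>

lemma (in laminar_family) nn_integral_chain_sum_le:
  assumes g: "\<And>a. a \<in> S \<Longrightarrow> 0 \<le> g a" and q: "0 < q"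
    and P: "\<And>a. a \<in> S \<Longrightarrow> P a \<in> sets M" "\<And>a. a \<in> S \<Longrightarrow> emeasure M (P a) \<le> ennreal (m a)"
    and m: "\<And>a. a \<in> S \<Longrightarrow> 0 \<le> m a"
  shows "(\<integral>\<^sup>+x. ennreal ((\<Sum>a | a \<in> S \<and> x \<in> P a. g a) powr q) \<partial>M)
    \<le> ennreal (\<Sum>a\<in>S. (up_sum g a powr q - (up_sum g a - g a) powr q) * m a)"
proof -
  define D where "D a = up_sum g a powr q - (up_sum g a - g a) powr q" for a
  have D: "0 \<le> D a" if "a \<in> S" for a
    using up_sum_ge[of a g, OF that g] q by (simp add: D_def powr_mono2)
  have "(\<integral>\<^sup>+x. ennreal ((\<Sum>a | a \<in> S \<and> x \<in> P a. g a) powr q) \<partial>M)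
      = (\<Sum>a\<in>S. ennreal (D a) * emeasure M (P a))"
    using P(1) by (simp add: chain_sum_powr_eq[OF g q] nn_integral_sum nn_integral_cmult_indicator
        flip: D_def)
  also have "\<dots> \<le> (\<Sum>a\<in>S. ennreal (D a) * ennreal (m a))"
    using P(2) by (intro sum_mono mult_left_mono) auto
  also have "\<dots> = (\<Sum>a\<in>S. ennreal (D a * m a))"
    using D by (intro sum.cong refl ennreal_mult'[symmetric]) auto
  also have "\<dots> = ennreal (\<Sum>a\<in>S. D a * m a)"
    using D m by (intro sum_ennreal) auto
  finally show ?thesis by (simp add: D_def)
qed

section \<open>The testing condition on dyadic squares\<close>

lemma ennpowr_ennreal: "0 \<le> x \<Longrightarrow> ennpowr (ennreal x) s = ennreal (x powr s)"
  by (simp add: ennpowr_def)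

lemma ennpowr_mono:
  assumes "x \<le> ennreal y" "0 \<le> y" "0 \<le> s"
  shows "ennpowr x s \<le> ennreal (y powr s)"
  using assms by (cases x rule: ennreal_cases) (auto simp: ennpowr_ennreal ennreal_leI powr_mono2 top_unique)

lemma borel_measure_on_right_half_plane_sets:
  assumes "borel_measure_on right_half_plane \<mu>" "A \<in> sets borel" "A \<subseteq> right_half_plane"
  shows "A \<in> sets \<mu>"
  using assms by (simp add: borel_measure_on_def sets_restrict_space_iff)

lemma borel_carleson_square: "carleson_square a \<inter> right_half_plane \<in> sets borel"
proof -
  have "carleson_square a \<inter> right_half_plane =
      {z. 0 < Re z} \<inter> {z. Re z < 2 * Re a} \<inter> {z. \<bar>Im z - Im a\<bar> \<le> Re a}"
    by (auto simp: carleson_square_def right_half_plane_def)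
  also have "\<dots> \<in> sets borel"
    by (intro sets.Int borel_open borel_closed open_Collect_less closed_Collect_le continuous_intros)
  finally show ?thesis .
qed

lemma borel_dyadic_cell: "dyadic_cell a \<in> sets borel"
proof -
  obtain j k where a: "a = (j, k)" by (cases a)
  have "dyadic_cell a = {z. 0 < Re z} \<inter> {z. Re z < side j} \<inter>
      {z. of_int k * side j \<le> Im z} \<inter> {z. Im z < (of_int k + 1) * side j}"
    by (auto simp: a dyadic_cell_def)
  also have "\<dots> \<in> sets borel"
    by (intro sets.Int borel_open borel_closed open_Collect_less closed_Collect_le continuous_intros)
  finally show ?thesis .
qed

text \<open>The area integral over the square of \<open>a\<close> is restricted to the disjoint
  cores of the cells below \<open>a\<close>. On the core of \<open>b\<close> the intersection of
  squares contains the square of \<open>b\<close>, and Re z and the weight are comparable to the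
  data of \<open>b\<close>.\<close>

lemma testing_condition_dyadic:
  fixes \<mu> :: "complex measure"
  defines "M \<equiv> \<lambda>a. measure \<mu> (carleson_square (cell_centre a) \<inter> right_half_plane)"
  assumes p: "1 < p'" "0 < q'" and test: "testing_condition p' q' \<mu> \<rho>"
    and \<mu>: "borel_measure_on right_half_plane \<mu>"
    and \<rho>: "\<And>z. z \<in> right_half_plane \<Longrightarrow> 0 < \<rho> z"
    and \<delta>: "0 < \<delta>" "\<And>a z w. z \<in> top_enlarged a \<Longrightarrow> w \<in> top_enlarged a \<Longrightarrow> \<rho> z \<le> \<delta> * \<rho> w"
  obtains C where "0 < C"
    "\<And>S a. finite S \<Longrightarrow> (\<Sum>b | b \<in> S \<and> dyadic_cell b \<subseteq> dyadic_cell a.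
        M b powr p' * \<rho> (cell_centre b) powr (1 - p')) \<le> C * M a powr (p' / q')"
    "\<And>a. emeasure \<mu> (carleson_square (cell_centre a) \<inter> right_half_plane) = ennreal (M a)"
proof -
  define Q where "Q a = carleson_square (cell_centre a) \<inter> right_half_plane" for a
  define I where "I a = (\<integral>\<^sup>+z\<in>Q a.
      ennpowr (emeasure \<mu> (carleson_square (cell_centre a) \<inter> carleson_square z \<inter> right_half_plane)) p'
        / ennreal ((Re z)\<^sup>2) * ennreal (\<rho> z powr (1 - p')) \<partial>lebesgue)" for a
  obtain C0 where C0: "0 < C0" and fin: "\<And>a. emeasure \<mu> (Q a) < \<infinity>"
    and T: "\<And>a. ennpowr (I a) (q' / p') \<le> ennreal C0 * emeasure \<mu> (Q a)"
    using test cell_centre_in unfolding testing_condition_def I_def Q_def by blast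
  have QM: "emeasure \<mu> (Q a) = ennreal (M a)" for a
    using fin[of a] unfolding M_def Q_def by (intro emeasure_eq_ennreal_measure) auto
  have M0: "0 \<le> M a" for a by (simp add: M_def)
  have Qs: "Q a \<in> sets \<mu>" for a
    unfolding Q_def by (intro borel_measure_on_right_half_plane_sets[OF \<mu>] borel_carleson_square) auto
  \<comment> \<open>The factor 16 is the inverse of the relative area of a core, the power of
    \<open>\<delta>\<close> pays for freezing the weight at the centre, and that of
    \<open>C0\<close> results from inverting the outer exponent q'/p'.\<close>
  define C where "C = 16 * \<delta> powr (p' - 1) * C0 powr (p' / q')"
  have centre: "cell_centre a \<in> top_enlarged a" for a
    by (cases a) (simp add: cell_centre_def top_enlarged_iff algebra_simps)
  have \<rho>0: "0 < \<rho> (cell_centre a)" for a by (rule \<rho>[OF cell_centre_in])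
  have "(\<Sum>b | b \<in> S \<and> dyadic_cell b \<subseteq> dyadic_cell a.
        M b powr p' * \<rho> (cell_centre b) powr (1 - p')) \<le> C * M a powr (p' / q')" if S: "finite S" for S a
  proof -
    define B where "B = {b. b \<in> S \<and> dyadic_cell b \<subseteq> dyadic_cell a}"
    have B: "finite B" using S by (simp add: B_def)
    \<comment> \<open>A lower bound for the integrand on the core of \<open>b\<close>. As 1 - p' <
      0, the upper bound \<open>\<delta> * \<rho> (cell_centre b)\<close> for the weight bounds its
      power from below.\<close>
    define k where "k b = M b powr p' / (side (fst b))\<^sup>2 * (\<delta> * \<rho> (cell_centre b)) powr (1 - p')" for b
    have k0: "0 \<le> k b" for b by (simp add: k_def)
    \<comment> \<open>Since \<open>ennpowr\<close> maps infinity to infinity, the finite right-hand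
      side forces the area integral to be finite.\<close>
    obtain i where i: "I a = ennreal i" "0 \<le> i"
    proof -
      have "ennpowr (I a) (q' / p') < \<infinity>"
        using T[of a] by (rule order.strict_trans1) (simp add: QM ennreal_mult_less_top)
      then have "I a \<noteq> \<infinity>" by (auto simp: ennpowr_def split: if_splits)
      then show ?thesis using that by (cases "I a" rule: ennreal_cases) auto
    qed
    have "i powr (q' / p') \<le> C0 * M a"
      using T[of a] i C0 M0[of a] by (simp add: ennpowr_ennreal QM ennreal_mult'[symmetric])
    then have "(i powr (q' / p')) powr (p' / q') \<le> (C0 * M a) powr (p' / q')"
      using p by (intro powr_mono2) auto
    then have i_le: "i \<le> C0 powr (p' / q') * M a powr (p' / q')"
      using p i(2) C0 M0[of a] by (simp add: powr_powr powr_mult)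
    have pw: "(\<Sum>b\<in>B. ennreal (k b) * indicator (top_core b) z)
        \<le> ennpowr (emeasure \<mu> (carleson_square (cell_centre a) \<inter> carleson_square z \<inter> right_half_plane)) p'
        / ennreal ((Re z)\<^sup>2) * ennreal (\<rho> z powr (1 - p')) * indicator (Q a) z" for z
    proof (cases "\<exists>b\<in>B. z \<in> top_core b")
      case False
      then have "(\<Sum>b\<in>B. ennreal (k b) * indicator (top_core b) z) = 0" by (intro sum.neutral) auto
      then show ?thesis by simp
    next
      case True
      then obtain b where b: "b \<in> B" "z \<in> top_core b" by blast
      have sub: "dyadic_cell b \<subseteq> dyadic_cell a" using b by (simp add: B_def)
      have zQ: "z \<in> Q a"
        using b(2) top_core_subset(1) sub dyadic_cell_subset_carleson unfolding Q_def by blast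
      then have z: "0 < Re z" "z \<in> right_half_plane" by (auto simp: Q_def right_half_plane_def)
      define U where "U = carleson_square (cell_centre a) \<inter> carleson_square z \<inter> right_half_plane"
      have U: "U \<in> sets \<mu>" "U \<subseteq> Q a"
      proof -
        have "U = Q a \<inter> (carleson_square z \<inter> right_half_plane)" by (auto simp: U_def Q_def)
        then show "U \<in> sets \<mu>"
          using Qs borel_measure_on_right_half_plane_sets[OF \<mu> borel_carleson_square, of z] by auto
      qed (auto simp: U_def Q_def)
      have "emeasure \<mu> U < \<infinity>"
        using emeasure_mono[OF U(2) Qs] fin[of a] by (rule order.strict_trans1)
      then have eU: "emeasure \<mu> U = ennreal (measure \<mu> U)"
        by (intro emeasure_eq_ennreal_measure) auto
      have "Q b \<subseteq> U"
        using carleson_cell_mono[OF sub] carleson_subset_core[OF b(2)] unfolding Q_def U_def by blast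
      from emeasure_mono[OF this U(1)] have MU: "M b \<le> measure \<mu> U"
        by (simp add: QM eU)
      have "Re z \<le> side (fst b)"
        using b(2) by (cases b) (auto simp: top_core_iff intro: less_imp_le order_trans)
      then have "(Re z)\<^sup>2 \<le> (side (fst b))\<^sup>2" using z by (intro power_mono) auto
      then have "M b powr p' / (side (fst b))\<^sup>2 \<le> measure \<mu> U powr p' / (Re z)\<^sup>2"
        using z p M0[of b] MU by (intro frac_le powr_mono2) auto
      moreover have "(\<delta> * \<rho> (cell_centre b)) powr (1 - p') \<le> \<rho> z powr (1 - p')"
      proof (rule powr_mono2')
        show "\<rho> z \<le> \<delta> * \<rho> (cell_centre b)"
          using \<delta>(2)[OF subsetD[OF top_core_subset(2) b(2)] centre] .
      qed (use p \<rho>[OF z(2)] in auto)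
      ultimately have "k b \<le> measure \<mu> U powr p' / (Re z)\<^sup>2 * \<rho> z powr (1 - p')"
        unfolding k_def by (intro mult_mono) auto
      then have kb: "ennreal (k b) \<le> ennpowr (emeasure \<mu> U) p' / ennreal ((Re z)\<^sup>2) * ennreal (\<rho> z powr (1 - p'))"
        using z by (simp add: eU ennpowr_ennreal divide_ennreal ennreal_mult'[symmetric] ennreal_leI)
      \<comment> \<open>Cores are disjoint, so the sum reduces to its single term at
        \<open>b\<close>.\<close>
      have "(\<Sum>c\<in>B. ennreal (k c) * indicator (top_core c) z) = (\<Sum>c\<in>{b}. ennreal (k c) * indicator (top_core c) z)"
      proof (rule sum.mono_neutral_right[OF B])
        show "\<forall>c\<in>B - {b}. ennreal (k c) * indicator (top_core c) z = 0"
        proof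
          fix c assume "c \<in> B - {b}"
          then have "z \<notin> top_core c" using top_core_disjoint[OF b(2), of c] by blast
          then show "ennreal (k c) * indicator (top_core c) z = 0" by simp
        qed
      qed (use b in simp)
      also have "\<dots> = ennreal (k b)" using b by simp
      finally show ?thesis using kb zQ by (simp add: U_def)
    qed
    have core: "top_core b \<in> sets borel" "emeasure lborel (top_core b) = ennreal ((side (fst b))\<^sup>2 / 16)" for b
      by (simp_all add: emeasure_top_core) (simp add: top_core_def split_beta')
    have "(\<Sum>b\<in>B. ennreal (k b * ((side (fst b))\<^sup>2 / 16)))
        = (\<Sum>b\<in>B. ennreal (k b) * emeasure lborel (top_core b))"
      unfolding core by (intro sum.cong refl ennreal_mult' k0)
    also have "\<dots> = (\<integral>\<^sup>+z. (\<Sum>b\<in>B. ennreal (k b) * indicator (top_core b) z) \<partial>lborel)"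
      using core by (simp add: nn_integral_sum nn_integral_cmult_indicator)
    also have "\<dots> = (\<integral>\<^sup>+z. (\<Sum>b\<in>B. ennreal (k b) * indicator (top_core b) z) \<partial>lebesgue)"
      by (simp add: nn_integral_completion)
    also have "\<dots> \<le> I a"
      unfolding I_def by (intro nn_integral_mono pw)
    finally have sum_le: "(\<Sum>b\<in>B. k b * ((side (fst b))\<^sup>2 / 16)) \<le> i"
      using k0 i by (subst (asm) sum_ennreal) auto
    have term_eq: "M b powr p' * \<rho> (cell_centre b) powr (1 - p')
        = 16 * \<delta> powr (p' - 1) * (k b * ((side (fst b))\<^sup>2 / 16))" for b
    proof -
      have "\<delta> powr (p' - 1) * (\<delta> * \<rho> (cell_centre b)) powr (1 - p') = \<rho> (cell_centre b) powr (1 - p')"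
        using \<delta>(1) \<rho>0[of b] by (simp add: powr_mult mult.assoc[symmetric] flip: powr_add)
      then show ?thesis
        using less_imp_neq[OF side_pos[of "fst b"]] by (simp add: k_def field_simps)
    qed
    have "(\<Sum>b\<in>B. M b powr p' * \<rho> (cell_centre b) powr (1 - p'))
        = 16 * \<delta> powr (p' - 1) * (\<Sum>b\<in>B. k b * ((side (fst b))\<^sup>2 / 16))"
      unfolding term_eq by (rule sum_distrib_left[symmetric])
    also have "\<dots> \<le> 16 * \<delta> powr (p' - 1) * (C0 powr (p' / q') * M a powr (p' / q'))"
      using order_trans[OF sum_le i_le] by (rule mult_left_mono) simp
    also have "\<dots> = C * M a powr (p' / q')" by (simp add: C_def mult.assoc)
    finally show ?thesis unfolding B_def .
  qed
  moreover have "0 < C" using \<delta> C0 by (simp add: C_def)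
  ultimately show ?thesis using that QM unfolding Q_def by blast
qed

section \<open>The embedding\<close>

lemma zen_norm_le_Ap_norm_pow:
  "zen_norm_pow p (half_plane_measure (N 0)) F \<le> Ap_norm_pow p m N F"
proof -
  have "(if enat 0 \<le> m then zen_norm_pow p (half_plane_measure (N 0)) ((deriv ^^ 0) F) else 0)
      \<le> Ap_norm_pow p m N F"
    unfolding Ap_norm_pow_def
    using sum_le_suminf[OF summableI, of "{0}" "\<lambda>n. if enat n \<le> m
      then zen_norm_pow p (half_plane_measure (N n)) ((deriv ^^ n) F) else 0"] by simp
  then show ?thesis by (simp flip: zero_enat_def)
qed

theorem theorem4:
  fixes p q p' q' :: real and m :: enat
    and N :: "nat \<Rightarrow> real measure" and \<mu> :: "complex measure" and \<rho> :: "complex \<Rightarrow> real"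
  assumes "1 < p" and "p \<le> q"
    and "p' = p / (p - 1)" and "q' = q / (q - 1)"
    and "\<And>n. enat n \<le> m \<Longrightarrow> regular_borel_measure_on {0..} (N n)"
    and "\<And>n. enat n \<le> m \<Longrightarrow> Delta2 (N n)"
    and "borel_measure_on right_half_plane \<mu>"
    and "regular_weight \<rho>"
    and "\<And>F. F \<in> Ap_space p m N \<Longrightarrow>
      (\<integral>\<^sup>+z\<in>right_half_plane. ennreal (cmod (deriv F z) powr p * Re z powr (p - 2) * \<rho> z) \<partial>lebesgue)
        \<le> Ap_norm_pow p m N F"
    and "testing_condition p' q' \<mu> \<rho>"
  shows "bounded_embedding p m N q \<mu>"
proof -
  have q: "1 < q" using assms(1,2) by simp
  have p': "1 < p'" using assms(1) unfolding assms(3) by (simp add: field_simps)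
  have q': "0 < q'" using q unfolding assms(4) by simp
  have r: "p' / q' = p' * (q - 1) / q" unfolding assms(4) by simp
  have \<rho>: "0 < \<rho> z" if "z \<in> right_half_plane" for z
    using assms(8) that by (simp add: regular_weight_def)
  obtain \<delta> where \<delta>: "0 < \<delta>"
    "\<And>a z w. z \<in> top_enlarged a \<Longrightarrow> w \<in> top_enlarged a \<Longrightarrow> \<rho> z \<le> \<delta> * \<rho> w"
    using regular_weight_comparable[OF assms(8)] by blast
  define M where "M a = measure \<mu> (carleson_square (cell_centre a) \<inter> right_half_plane)" for a
  obtain C where C: "0 < C"
    and test: "\<And>S a. finite S \<Longrightarrow> (\<Sum>b | b \<in> S \<and> dyadic_cell b \<subseteq> dyadic_cell a.
        M b powr p' * \<rho> (cell_centre b) powr (1 - p')) \<le> C * M a powr (p' / q')"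
    and M: "\<And>a. emeasure \<mu> (carleson_square (cell_centre a) \<inter> right_half_plane) = ennreal (M a)"
  proof (rule testing_condition_dyadic[OF p' q' assms(10,7) _ \<delta>(1), folded M_def])
    show "0 < \<rho> z" if "z \<in> right_half_plane" for z using that by (rule \<rho>)
    show "\<rho> z \<le> \<delta> * \<rho> w" if "z \<in> top_enlarged a" "w \<in> top_enlarged a" for a z w
      using that by (rule \<delta>(2))
  qed (rule that)
  have Qs: "carleson_square a \<inter> right_half_plane \<in> sets \<mu>" for a
    by (intro borel_measure_on_right_half_plane_sets[OF assms(7)] borel_carleson_square) auto
  have M0: "0 \<le> M a" for a by (simp add: M_def)
  have M_mono: "M b \<le> M a" if "dyadic_cell b \<subseteq> dyadic_cell a" for a b
    using emeasure_mono[OF carleson_cell_mono[OF that] Qs] M0 by (simp add: M)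
  have cells: "dyadic_cell a \<in> sets \<mu>" for a
    using borel_measure_on_right_half_plane_sets[OF assms(7) borel_dyadic_cell, of a]
      dyadic_cell_subset_carleson[of a] by blast
  have cellM: "emeasure \<mu> (dyadic_cell a) \<le> ennreal (M a)" for a
    using emeasure_mono[OF dyadic_cell_subset_carleson Qs] by (simp add: M)
  define K where "K = 16 * (8 * 32 powr (p - 1)) * (9 * 4 powr \<bar>p - 2\<bar> * \<delta>)"
  have K: "0 < K" using \<delta>(1) by (simp add: K_def)
  \<comment> \<open>The constant of \<open>testing_imp_hardy\<close>, with r written out as p' (q -
    1)/q.\<close>
  define H where "H = 2 * q * (2 * q * (C * (p' * (q - 1) / q))) powr (p - 1)"
  have H: "0 < H" using q p' C by (simp add: H_def)
  \<comment> \<open>The factor 2 is that of \<open>norm_le_sum_oscillations\<close>;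
    \<open>H\<close> and \<open>K\<close> enter as p-th roots because they bound X^(p/q), and X
    bounds the integral of a q-th power.\<close>
  define A where "A = 2 * (H * K) powr (1 / p)"
  have "ennpowr (\<integral>\<^sup>+z. ennreal (cmod (F z) powr q) \<partial>\<mu>) (1 / q) \<le> ennreal A * Ap_norm p m N F"
    if FA: "F \<in> Ap_space p m N" for F
  proof -
    have F: "F holomorphic_on right_half_plane" using FA by (simp add: Ap_space_def)
    obtain v where v: "Ap_norm_pow p m N F = ennreal v" "0 \<le> v"
      using FA by (cases "Ap_norm_pow p m N F" rule: ennreal_cases) (auto simp: Ap_space_def)
    have lim: "((\<lambda>x. F (Complex x y)) \<longlongrightarrow> 0) at_top" for y
    proof (rule tendsto_0_at_right[of "N 0"])
      show "borel_measure_on {0..} (N 0)" "Delta2 (N 0)"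
        using assms(5,6)[of 0] by (simp_all add: regular_borel_measure_on_def flip: zero_enat_def)
      show "zen_norm_pow p (half_plane_measure (N 0)) F < \<infinity>"
        using zen_norm_le_Ap_norm_pow[of p N F m] by (rule order.strict_trans1) (simp add: v)
    qed (use assms(1) F in auto)
    obtain \<zeta> where \<zeta>: "\<And>a. \<zeta> a \<in> top_half a"
      "\<And>a z. z \<in> top_half a \<Longrightarrow> cmod (deriv F z) \<le> cmod (deriv F (\<zeta> a))"
      using exists_max_on_top_half[OF F] by blast
    define g where "g a = side (fst a) * cmod (deriv F (\<zeta> a))" for a
    have g0: "0 \<le> g a" for a by (simp add: g_def)
    have g_sum: "(\<Sum>a\<in>S. g a powr p * \<rho> (cell_centre a)) \<le> K * v" if "finite S" for S
    proof -
      have "ennreal (\<Sum>a\<in>S. g a powr p * \<rho> (cell_centre a))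
          \<le> ennreal K * (\<integral>\<^sup>+z\<in>right_half_plane. ennreal (cmod (deriv F z) powr p * Re z powr (p - 2) * \<rho> z) \<partial>lebesgue)"
        unfolding g_def K_def using assms(1) F \<rho> \<delta> \<zeta>(1) that by (intro sum_oscillations_le) auto
      also have "\<dots> \<le> ennreal K * ennreal v"
        using assms(9)[OF FA] unfolding v(1) by (rule mult_left_mono) simp
      finally show ?thesis using K v(2) by (simp add: ennreal_mult'[symmetric])
    qed
    define f where "f n z = (\<Sum>a | a \<in> index_box n \<and> z \<in> dyadic_cell a. g a)" for n z
    have f0: "0 \<le> f n z" for n z by (simp add: f_def sum_nonneg g0)
    \<comment> \<open>This bound does not depend on \<open>n\<close>, so it survives the supremum
      over the index boxes.\<close>
    define Y where "Y = (H * (K * v)) powr (q / p)"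
    have f_int: "(\<integral>\<^sup>+z. ennreal (f n z powr q) \<partial>\<mu>) \<le> ennreal Y"
      and f_meas: "(\<lambda>z. ennreal (f n z powr q)) \<in> borel_measurable \<mu>" for n
    proof -
      interpret L: laminar_family "index_box n" dyadic_cell fst
        by (rule laminar_dyadic) simp
      define X where "X = (\<Sum>a\<in>index_box n. (L.up_sum g a powr q - (L.up_sum g a - g a) powr q) * M a)"
      have X0: "0 \<le> X"
        unfolding X_def using L.up_sum_ge[of _ g] g0 q M0
        by (intro sum_nonneg mult_nonneg_nonneg) (auto simp: powr_mono2)
      have "X powr (p / q) \<le> H * (\<Sum>a\<in>index_box n. g a powr p * \<rho> (cell_centre a))"
        unfolding X_def H_def
      proof (rule L.testing_imp_hardy)
        show "(\<Sum>b | b \<in> index_box n \<and> dyadic_cell b \<subseteq> dyadic_cell a.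
            M b powr p' * \<rho> (cell_centre b) powr (1 - p')) \<le> C * M a powr (p' * (q - 1) / q)" for a
          using test[of "index_box n" a] by (simp add: r)
      qed (use assms(1-3) C g0 M0 M_mono \<rho>[OF cell_centre_in] in auto)
      also have "\<dots> \<le> H * (K * v)" using H g_sum by (intro mult_left_mono) auto
      finally have "(X powr (p / q)) powr (q / p) \<le> Y"
        unfolding Y_def using assms(1) q by (intro powr_mono2) auto
      then have "X \<le> Y" using X0 assms(1) q by (simp add: powr_powr)
      then have XY: "ennreal X \<le> ennreal Y" by (rule ennreal_leI)
      have "(\<integral>\<^sup>+z. ennreal (f n z powr q) \<partial>\<mu>) \<le> ennreal X"
        unfolding f_def X_def using g0 q cells cellM M0 by (intro L.nn_integral_chain_sum_le) auto
      with XY show "(\<integral>\<^sup>+z. ennreal (f n z powr q) \<partial>\<mu>) \<le> ennreal Y" by (rule order_trans[rotated])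
      show "(\<lambda>z. ennreal (f n z powr q)) \<in> borel_measurable \<mu>"
        unfolding f_def L.chain_sum_powr_eq[OF g0 less_trans[OF zero_less_one q]]
        by (intro borel_measurable_sum borel_measurable_times_ennreal borel_measurable_const
            borel_measurable_indicator cells)
    qed
    have inc: "incseq (\<lambda>n z. ennreal (f n z powr q))"
    proof (intro incseq_SucI le_funI ennreal_leI powr_mono2 f0)
      show "f n z \<le> f (Suc n) z" for n z
        unfolding f_def using index_box_mono[of n "Suc n"] g0 by (intro sum_mono2) auto
    qed (use q in auto)
    \<comment> \<open>The number \<open>n\<close> supplied for |F z| depends on z; the supremum over
      \<open>n\<close> removes this dependence before integrating.\<close>
    have pw: "ennreal (cmod (F z) powr q) \<le> ennreal (2 powr q) * (SUP n. ennreal (f n z powr q))"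
      if z: "z \<in> space \<mu>" for z
    proof -
      have "z \<in> right_half_plane"
        using z sets_eq_imp_space_eq[OF assms(7)[unfolded borel_measure_on_def]]
        by (simp add: space_restrict_space)
      from norm_le_sum_oscillations[OF F lim \<zeta>(2) this g_def]
      obtain n where n: "cmod (F z) \<le> 2 * f n z" by (auto simp: f_def)
      then have "cmod (F z) powr q \<le> 2 powr q * f n z powr q"
        using q f0[of n z] powr_mono2[of q "cmod (F z)" "2 * f n z"] by (simp add: powr_mult)
      then have "ennreal (cmod (F z) powr q) \<le> ennreal (2 powr q) * ennreal (f n z powr q)"
        by (simp add: ennreal_mult'[symmetric] ennreal_leI)
      also have "\<dots> \<le> ennreal (2 powr q) * (SUP n. ennreal (f n z powr q))"
        by (intro mult_left_mono SUP_upper) auto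
      finally show ?thesis .
    qed
    have "(\<integral>\<^sup>+z. ennreal (cmod (F z) powr q) \<partial>\<mu>)
        \<le> (\<integral>\<^sup>+z. ennreal (2 powr q) * (SUP n. ennreal (f n z powr q)) \<partial>\<mu>)"
      by (rule nn_integral_mono[OF pw])
    also have "\<dots> = ennreal (2 powr q) * (\<integral>\<^sup>+z. (SUP n. ennreal (f n z powr q)) \<partial>\<mu>)"
      using f_meas by (intro nn_integral_cmult) auto
    also have "(\<integral>\<^sup>+z. (SUP n. ennreal (f n z powr q)) \<partial>\<mu>) = (SUP n. \<integral>\<^sup>+z. ennreal (f n z powr q) \<partial>\<mu>)"
      by (rule nn_integral_monotone_convergence_SUP[OF inc f_meas])
    also have "ennreal (2 powr q) * (SUP n. \<integral>\<^sup>+z. ennreal (f n z powr q) \<partial>\<mu>) \<le> ennreal (2 powr q) * ennreal Y"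
      by (intro mult_left_mono SUP_least f_int) auto
    also have "\<dots> = ennreal (2 powr q * Y)" by (simp add: ennreal_mult')
    finally have "ennpowr (\<integral>\<^sup>+z. ennreal (cmod (F z) powr q) \<partial>\<mu>) (1 / q) \<le> ennreal ((2 powr q * Y) powr (1 / q))"
      using q by (intro ennpowr_mono) (auto simp: Y_def)
    also have "(2 powr q * Y) powr (1 / q) = A * v powr (1 / p)"
      using q H K v(2) by (simp add: Y_def A_def powr_mult powr_powr)
    also have "ennreal (A * v powr (1 / p)) = ennreal A * Ap_norm p m N F"
      unfolding Ap_norm_def v(1) using v(2) by (simp add: ennpowr_ennreal A_def ennreal_mult')
    finally show ?thesis .
  qed
  moreover have "0 < A" using H K by (simp add: A_def)
  ultimately show ?thesis unfolding bounded_embedding_def by blast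
qed

end
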